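(* Let $\gamma>1$, $\mu>1$, $m>0$, $\delta>0$ and $(u_0,v_0)\in X_{m,\delta}$. Let $a\in C^1_b([0,\infty)\times\mathbb{R})$ satisfy either (i) for some function $a(t)$, $\lim_{x\to-\infty}a(t,x)=a(t)$ for all $t\ge 0$, and $$0\le a(t,x)\le A_1(1+t)^{-\mu},\qquad |a_t(t,x)|+|a_x(t,x)|\le A_2(1+t)^{-\mu}$$ for all $(t,x)\in[0,\infty)\times\mathbb{R}$; or (ii) $$0\le a(t,x)\le A_3(1+|x|)^{-\mu},\qquad |a_t(t,x)|+|a_x(t,x)|\le A_4(1+|x|)^{-\mu}$$ for all $(t,x)\in[0,\infty)\times\mathbb{R}$, where $A_1,A_2,A_3,A_4>0$ are constants. Suppose that for some $u_->0$ and $v_-\in\mathbb{R}$ $$\lim_{x\to-\infty}(u_0(x),v_0(x))=(u_-,v_-).$$ Let $(u,v)$ be the $C^1$ solution of $$u_t-v_x=0,\qquad v_t+p(u)_x=-a(t,x)v,\qquad (u,v)(0,x)=(u_0(x),v_0(x)),$$ with lifespan $T^*$. Then there exists $\tilde\varepsilon>0$ depending on $m,\delta,A_1$ and $A_3$ such that if $$\sup_{(x,y)\in\mathbb{R}^2}|s(0,x)+r(0,y)|<\tilde\varepsilon,$$ then there are constants $m_1>0$ and $\delta_1>0$ depending on $m,\delta,A_1$ and $A_3$ such that $(u(t),v(t))\in X_{m_1,\delta_1}$ for all $t\in[0,T^* )$. Furthermore, there is a constant $K$ depending on $m$, $\delta$ and $A_j$ ($j=1,2,3,4$) such that if, in addition,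 $$r_x(0,x_0)\le -K\quad\text{or}\quad s_x(0,x_0)\le -K$$ for some $x_0\in\mathbb{R}$, then $T^*<\infty$.
   Context: Pressure: $p(u)=u^{-\gamma}/\gamma$ with $\gamma>1$. Put $c(u)=\sqrt{-p'(u)}=u^{-(\gamma+1)/2}$ and $\eta(u)=\int_u^\infty c(\xi)\,d\xi=\frac{2}{\gamma-1}u^{-(\gamma-1)/2}$. For a solution $(u,v)$ with $u>0$, the Riemann invariants are $r(t,x)=v(t,x)-\eta(u(t,x))$ and $s(t,x)=v(t,x)+\eta(u(t,x))$; at $t=0$ they are computed from $(u_0,v_0)$. $C^1_b(\Omega)$ is the set of bounded $C^1$ functions on $\Omega$ with bounded first partial derivatives. For $m,\delta>0$, $$X_{m,\delta}=\{(u,v)\in C^1_b(\mathbb{R})\times C^1_b(\mathbb{R}) : \|u\|_{L^\infty}+\|v\|_{L^\infty}\le m,\ u(x)\ge\delta\ \text{for all }x\in\mathbb{R}\}.$$ For initial data in $C^1_b(\mathbb{R})$ with $\inf u_0>0$ the Cauchy problem ($t\ge0$, $x\in\mathbb{R}$) has a unique local $C^1$ solution. The lifespan is $$T^*=\sup\Big\{T>0 : \text{the }C^1\text{ solution exists on }[0,T)\times\mathbb{R}\text{ and }\sup_{t\in[0,T)}\big(\|(u,v)(t)\|_{L^\infty}+\|(u_t,v_t)(t)\|_{L^\infty}+\|(u_x,v_x)(t)\|_{L^\infty}+\|p'(u(t))\|_{L^\infty}\big)<\infty\Big\}.$$ All constants ($\tilde\varepsilon,m_1,\delta_1,K$) may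 also depend on the fixed parameters $\gamma,\mu$. Dependence on $A_1,A_2$ is relevant in case (i), on $A_3,A_4$ in case (ii). *)

theory Defs
  imports "HOL-Analysis.Analysis"
begin

definition pressure :: "real \<Rightarrow> real \<Rightarrow> real" where
  "pressure \<gamma> u = u powr (-\<gamma>) / \<gamma>"

definition sound_speed :: "real \<Rightarrow> real \<Rightarrow> real" where
  "sound_speed \<gamma> u = sqrt (- deriv (pressure \<gamma>) u)"

definition eta :: "real \<Rightarrow> real \<Rightarrow> real" where
  "eta \<gamma> u = integral {u..} (sound_speed \<gamma>)"

definition riemann_r :: "real \<Rightarrow> real \<Rightarrow> real \<Rightarrow> real" where
  "riemann_r \<gamma> u v = v - eta \<gamma> u"

definition riemann_s :: "real \<Rightarrow> real \<Rightarrow> real \<Rightarrow> real" where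
  "riemann_s \<gamma> u v = v + eta \<gamma> u"

lemma deriv_pressure:
  assumes "\<gamma> > 1" "u > 0"
  shows "deriv (pressure \<gamma>) u = - (u powr (-(\<gamma> + 1)))"
proof -
  have "(pressure \<gamma> has_real_derivative (- \<gamma> * u powr (- \<gamma> - 1)) / \<gamma>) (at u)"
    unfolding pressure_def using assms
    by (auto intro!: derivative_eq_intros simp: field_simps)
  then show ?thesis
    using assms by (simp add: DERIV_imp_deriv add.commute minus_diff_commute)
qed

lemma sound_speed_eq:
  assumes "\<gamma> > 1" "u > 0"
  shows "sound_speed \<gamma> u = u powr (-(\<gamma> + 1) / 2)"
  using assms by (simp add: sound_speed_def deriv_pressure powr_half_sqrt_powr)

lemma eta_eq:
  assumes "\<gamma> > 1" "u > 0"
  shows "eta \<gamma> u = 2 / (\<gamma> - 1) * u powr (-(\<gamma> - 1) / 2)"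
proof -
  have "((\<lambda>x. x powr (-(\<gamma> + 1) / 2)) has_integral
           -(u powr (-(\<gamma> + 1) / 2 + 1)) / (-(\<gamma> + 1) / 2 + 1)) {u..}"
    using assms by (intro has_integral_powr_to_inf) auto
  then have "(sound_speed \<gamma> has_integral
           -(u powr (-(\<gamma> + 1) / 2 + 1)) / (-(\<gamma> + 1) / 2 + 1)) {u..}"
    by (rule has_integral_eq[rotated]) (use assms in \<open>auto simp: sound_speed_eq\<close>)
  moreover have "-(\<gamma> + 1) / 2 + 1 = -(\<gamma> - 1) / 2"
    by (simp add: field_simps)
  ultimately show ?thesis
    using assms by (simp add: eta_def integral_unique field_simps)
qed

text \<open>The supremum norm takes values in the extended reals, so that it is meaningful
  (and infinite) for unbounded functions as well.\<close>

definition sup_norm :: "('b \<Rightarrow> 'a::real_normed_vector) \<Rightarrow> ereal" where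
  "sup_norm f = (SUP x. ereal (norm (f x)))"

definition C1b :: "(real \<Rightarrow> real) set" where
  "C1b = {f. f C1_differentiable_on UNIV \<and> bounded (range f) \<and> bounded (range (deriv f))}"

definition X_space :: "real \<Rightarrow> real \<Rightarrow> ((real \<Rightarrow> real) \<times> (real \<Rightarrow> real)) set" where
  "X_space m \<delta> =
     {(u, v). u \<in> C1b \<and> v \<in> C1b \<and> sup_norm u + sup_norm v \<le> ereal m \<and> (\<forall>x. \<delta> \<le> u x)}"

text \<open>Functions of \<open>(t, x)\<close> are total; only their values for \<open>t \<ge> 0\<close> matter. Hence the time
  derivative is relative to the half-line \<open>{0..}\<close>: it is one-sided at \<open>t = 0\<close> and the
  ordinary derivative for \<open>t > 0\<close>.\<close>

definition dt :: "(real \<Rightarrow> real \<Rightarrow> real) \<Rightarrow> real \<Rightarrow> real \<Rightarrow> real" where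
  "dt f t x = vector_derivative (\<lambda>\<tau>. f \<tau> x) (at t within {0..})"

definition dx :: "(real \<Rightarrow> real \<Rightarrow> real) \<Rightarrow> real \<Rightarrow> real \<Rightarrow> real" where
  "dx f t x = deriv (f t) x"

text \<open>Here the time set \<open>I\<close> is \<open>{0..}\<close> or \<open>{0..<T}\<close>.\<close>

definition C1_on :: "real set \<Rightarrow> (real \<Rightarrow> real \<Rightarrow> real) \<Rightarrow> bool" where
  "C1_on I f \<longleftrightarrow>
     (\<forall>t\<in>I. \<forall>x. (\<lambda>\<tau>. f \<tau> x) differentiable (at t within {0..}) \<and> f t differentiable (at x)) \<and>
     continuous_on (I \<times> UNIV) (\<lambda>(t, x). f t x) \<and>
     continuous_on (I \<times> UNIV) (\<lambda>(t, x). dt f t x) \<and>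
     continuous_on (I \<times> UNIV) (\<lambda>(t, x). dx f t x)"

definition C1b_on :: "real set \<Rightarrow> (real \<Rightarrow> real \<Rightarrow> real) \<Rightarrow> bool" where
  "C1b_on I f \<longleftrightarrow> C1_on I f \<and>
     bounded ((\<lambda>(t, x). f t x) ` (I \<times> UNIV)) \<and>
     bounded ((\<lambda>(t, x). dt f t x) ` (I \<times> UNIV)) \<and>
     bounded ((\<lambda>(t, x). dx f t x) ` (I \<times> UNIV))"

definition time_damping :: "real \<Rightarrow> real \<Rightarrow> real \<Rightarrow> (real \<Rightarrow> real \<Rightarrow> real) \<Rightarrow> bool" where
  "time_damping \<mu> A\<^sub>1 A\<^sub>2 a \<longleftrightarrow> C1b_on {0..} a \<and>
     (\<exists>b. \<forall>t\<ge>0. (a t \<longlongrightarrow> b t) at_bot) \<and>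
     (\<forall>t\<ge>0. \<forall>x. 0 \<le> a t x \<and> a t x \<le> A\<^sub>1 * (1 + t) powr (-\<mu>) \<and>
                \<bar>dt a t x\<bar> + \<bar>dx a t x\<bar> \<le> A\<^sub>2 * (1 + t) powr (-\<mu>))"

definition space_damping :: "real \<Rightarrow> real \<Rightarrow> real \<Rightarrow> (real \<Rightarrow> real \<Rightarrow> real) \<Rightarrow> bool" where
  "space_damping \<mu> A\<^sub>3 A\<^sub>4 a \<longleftrightarrow> C1b_on {0..} a \<and>
     (\<forall>t\<ge>0. \<forall>x. 0 \<le> a t x \<and> a t x \<le> A\<^sub>3 * (1 + \<bar>x\<bar>) powr (-\<mu>) \<and>
                \<bar>dt a t x\<bar> + \<bar>dx a t x\<bar> \<le> A\<^sub>4 * (1 + \<bar>x\<bar>) powr (-\<mu>))"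

definition C1_solution ::
  "real \<Rightarrow> (real \<Rightarrow> real \<Rightarrow> real) \<Rightarrow> (real \<Rightarrow> real) \<Rightarrow> (real \<Rightarrow> real) \<Rightarrow>
   real \<Rightarrow> (real \<Rightarrow> real \<Rightarrow> real) \<Rightarrow> (real \<Rightarrow> real \<Rightarrow> real) \<Rightarrow> bool" where
  "C1_solution \<gamma> a u\<^sub>0 v\<^sub>0 T u v \<longleftrightarrow>
     C1_on {0..<T} u \<and> C1_on {0..<T} v \<and>
     (\<forall>x. u 0 x = u\<^sub>0 x \<and> v 0 x = v\<^sub>0 x) \<and>
     (\<forall>t\<in>{0..<T}. \<forall>x.
        u t x > 0 \<and>
        dt u t x - dx v t x = 0 \<and>
        dt v t x + dx (\<lambda>t x. pressure \<gamma> (u t x)) t x = - a t x * v t x)"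

definition regular_solution ::
  "real \<Rightarrow> (real \<Rightarrow> real \<Rightarrow> real) \<Rightarrow> (real \<Rightarrow> real) \<Rightarrow> (real \<Rightarrow> real) \<Rightarrow>
   real \<Rightarrow> (real \<Rightarrow> real \<Rightarrow> real) \<Rightarrow> (real \<Rightarrow> real \<Rightarrow> real) \<Rightarrow> bool" where
  "regular_solution \<gamma> a u\<^sub>0 v\<^sub>0 T u v \<longleftrightarrow>
     C1_solution \<gamma> a u\<^sub>0 v\<^sub>0 T u v \<and>
     (SUP t\<in>{0..<T}. sup_norm (\<lambda>x. (u t x, v t x)) + sup_norm (\<lambda>x. (dt u t x, dt v t x)) +
        sup_norm (\<lambda>x. (dx u t x, dx v t x)) + sup_norm (\<lambda>x. deriv (pressure \<gamma>) (u t x))) < \<infinity>"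

definition lifespan ::
  "real \<Rightarrow> (real \<Rightarrow> real \<Rightarrow> real) \<Rightarrow> (real \<Rightarrow> real) \<Rightarrow> (real \<Rightarrow> real) \<Rightarrow> ereal" where
  "lifespan \<gamma> a u\<^sub>0 v\<^sub>0 = Sup {ereal T | T. 0 < T \<and> (\<exists>u v. regular_solution \<gamma> a u\<^sub>0 v\<^sub>0 T u v)}"

text \<open>The \<open>C\<^sup>1\<close> solution on \<open>[0, T\<^sup>*)\<close>: by uniqueness, the solutions witnessing the lifespan are
  restrictions of one pair \<open>(u, v)\<close>, so the norms of this pair are bounded on \<open>[0, T)\<close> for each
  \<open>T < T\<^sup>*\<close>. Nothing is required at or beyond \<open>T\<^sup>*\<close>.\<close>

definition solution_on_lifespan ::
  "real \<Rightarrow> (real \<Rightarrow> real \<Rightarrow> real) \<Rightarrow> (real \<Rightarrow> real) \<Rightarrow> (real \<Rightarrow> real) \<Rightarrow>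
   (real \<Rightarrow> real \<Rightarrow> real) \<Rightarrow> (real \<Rightarrow> real \<Rightarrow> real) \<Rightarrow> bool" where
  "solution_on_lifespan \<gamma> a u\<^sub>0 v\<^sub>0 u v \<longleftrightarrow>
     (\<forall>T>0. ereal T < lifespan \<gamma> a u\<^sub>0 v\<^sub>0 \<longrightarrow> regular_solution \<gamma> a u\<^sub>0 v\<^sub>0 T u v)"

end

theory Submission
  imports Defs
begin

text \<open>
  The functions \<open>s\<close> and \<open>-r\<close> are transported with speeds \<open>c\<close> and \<open>-c\<close>, and since
  \<open>v = (s - (-r)) / 2\<close> the damping term \<open>-a v\<close> only pulls them towards each other. By the maximum
  principle every interval \<open>[L, M]\<close> containing the initial values of both is preserved. Smallness
  of \<open>s(0, x) + r(0, y)\<close> makes \<open>v\<^sub>0\<close> small compared with \<open>\<eta>(u\<^sub>0) \<ge> \<eta>(m)\<close>, so that \<open>L = \<eta>(m) / 2\<close>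
  is admissible, and \<open>L \<le> \<eta>(u) \<le> M\<close> bounds \<open>u\<close> on both sides.

  With these bounds the spatial derivative of a Riemann invariant along its characteristic satisfies
  (after multiplication by a power of \<open>u\<close> and a bounded shift) a Riccati equation
  \<open>z' \<le> -k z\<^sup>2 + O(1 + |z|)\<close> whose coefficients are controlled by \<open>m\<close>, \<open>\<delta>\<close> and the bounds of the
  damping, so a sufficiently negative initial slope blows up before time 1. The derivative is only
  continuous a priori; that it is differentiable along characteristics follows by passing to the limit
  in difference quotients.
\<close>

subsection \<open>Ordinary differential equations and characteristics\<close>

text \<open>Rescaling by \<open>exp (2 * L * t)\<close> makes the integral operator a contraction
  with factor 1/2 on the whole interval, so a single use of Banach's fixed point theorem reaches
  \<open>T\<close>; the interval is not cut into short pieces.\<close>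

lemma picard_lindelof:
  fixes F :: "real \<Rightarrow> real \<Rightarrow> real"
  assumes T: "0 \<le> T" and L: "0 < L"
    and cont: "continuous_on ({0..T} \<times> UNIV) (\<lambda>(t, x). F t x)"
    and lip: "\<And>t x y. t \<in> {0..T} \<Longrightarrow> \<bar>F t x - F t y\<bar> \<le> L * \<bar>x - y\<bar>"
  obtains X where "X 0 = x\<^sub>0"
    and "\<And>t. t \<in> {0..T} \<Longrightarrow> (X has_real_derivative F t (X t)) (at t within {0..T})"
proof -
  \<comment> \<open>Clamping the time to [0, T] turns functions on the interval into bounded
    continuous functions on the real line, which form a complete space.\<close>
  define q where "q t = max 0 (min t T)" for t :: real
  have q: "q t \<in> {0..T}" for t using T by (auto simp: q_def)
  have q_id: "q t = t" if "t \<in> {0..T}" for t using that by (auto simp: q_def)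
  have cont_q: "continuous_on UNIV q" unfolding q_def by (intro continuous_intros)
  define J where "J y t = x\<^sub>0 + integral {0..t} (\<lambda>\<tau>. F \<tau> (y \<tau>))" for y t
  have cont_F: "continuous_on {0..T} (\<lambda>\<tau>. F \<tau> (y \<tau>))" if "continuous_on {0..T} y" for y
    using continuous_on_compose2[OF cont continuous_on_Pair[OF continuous_on_id that]] by auto
  have cont_J: "continuous_on {0..T} (J y)" if "continuous_on {0..T} y" for y
    unfolding J_def by (intro continuous_intros indefinite_integral_continuous_1
        integrable_continuous_real cont_F that)
  \<comment> \<open>The argument of \<open>H\<close> is the unknown divided by the weight
    \<open>exp (2 * L * t)\<close>: the weight is put back, the integral operator \<open>J\<close>
    is applied, and the weight is divided out again.\<close>
  define H where "H y t = exp (- 2 * L * q t) * J (\<lambda>\<tau>. exp (2 * L * \<tau>) * y \<tau>) (q t)" for y t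
  define \<Phi> where "\<Phi> Y = Bcontfun (H (apply_bcontfun Y))" for Y :: "real \<Rightarrow>\<^sub>C real"
  have cont_w: "continuous_on S (\<lambda>\<tau>. exp (2 * L * \<tau>) * apply_bcontfun Y \<tau>)"
    for Y :: "real \<Rightarrow>\<^sub>C real" and S
    by (intro continuous_intros continuous_on_apply_bcontfun)
  have H: "H (apply_bcontfun Y) \<in> bcontfun" for Y :: "real \<Rightarrow>\<^sub>C real"
  proof -
    let ?g = "\<lambda>t. exp (- 2 * L * t) * J (\<lambda>\<tau>. exp (2 * L * \<tau>) * Y \<tau>) t"
    have c: "continuous_on {0..T} ?g" by (intro continuous_intros cont_J cont_w)
    have "continuous_on UNIV (\<lambda>t. ?g (q t))"
      by (rule continuous_on_compose2[OF c cont_q]) (use q in auto)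
    moreover have "bounded (range (\<lambda>t. ?g (q t)))"
      by (rule bounded_subset[OF compact_imp_bounded[OF compact_continuous_image[OF c]]])
        (use q in auto)
    ultimately show ?thesis by (simp add: H_def[abs_def] bcontfun_def)
  qed
  have app: "apply_bcontfun (\<Phi> Y) = H (apply_bcontfun Y)" for Y
    unfolding \<Phi>_def by (rule Bcontfun_inverse[OF H])
  have contr: "dist (\<Phi> Y) (\<Phi> Z) \<le> 1/2 * dist Y Z" for Y Z
  proof (rule dist_bound)
    fix t
    define s where "s = q t"
    have s: "0 \<le> s" "s \<le> T" using q[of t] by (auto simp: s_def)
    define D where "D = dist Y Z"
    have D: "0 \<le> D" by (simp add: D_def)
    let ?F = "\<lambda>Y \<tau>. F \<tau> (exp (2 * L * \<tau>) * apply_bcontfun Y \<tau>)"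
    have int: "?F Y integrable_on {0..s}" for Y
      by (rule integrable_continuous_real, rule continuous_on_subset[OF cont_F[OF cont_w]])
        (use s in auto)
    \<comment> \<open>The Lipschitz bound integrates to \<open>(exp (2 * L * s) - 1) / 2\<close>,
      and the outer factor \<open>exp (- 2 * L * s)\<close> brings this below 1/2 uniformly in
      \<open>s\<close>.\<close>
    have E: "((\<lambda>\<tau>. L * exp (2 * L * \<tau>) * D) has_integral
        (exp (2 * L * s) / 2 * D - exp (2 * L * 0) / 2 * D)) {0..s}"
      by (rule fundamental_theorem_of_calculus)
        (use s L in \<open>auto intro!: derivative_eq_intros
          simp flip: has_real_derivative_iff_has_vector_derivative\<close>)
    have "norm (integral {0..s} (\<lambda>\<tau>. ?F Y \<tau> - ?F Z \<tau>))
        \<le> integral {0..s} (\<lambda>\<tau>. L * exp (2 * L * \<tau>) * D)"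
    proof (rule integral_norm_bound_integral)
      show "(\<lambda>\<tau>. ?F Y \<tau> - ?F Z \<tau>) integrable_on {0..s}" by (intro integrable_diff int)
      show "(\<lambda>\<tau>. L * exp (2 * L * \<tau>) * D) integrable_on {0..s}" using E by blast
      fix \<tau> assume \<tau>: "\<tau> \<in> {0..s}"
      have "norm (?F Y \<tau> - ?F Z \<tau>) \<le> L * \<bar>exp (2 * L * \<tau>) * Y \<tau> - exp (2 * L * \<tau>) * Z \<tau>\<bar>"
        using lip[of \<tau>] \<tau> s by auto
      also have "\<dots> = L * exp (2 * L * \<tau>) * dist (Y \<tau>) (Z \<tau>)"
        by (simp add: dist_real_def abs_mult flip: right_diff_distrib)
      also have "\<dots> \<le> L * exp (2 * L * \<tau>) * D"
        using L unfolding D_def by (intro mult_left_mono dist_bounded) auto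
      finally show "norm (?F Y \<tau> - ?F Z \<tau>) \<le> L * exp (2 * L * \<tau>) * D" .
    qed
    also have "\<dots> = (exp (2 * L * s) - 1) / 2 * D"
      using integral_unique[OF E] by (simp add: field_simps)
    finally have *: "\<bar>integral {0..s} (?F Y) - integral {0..s} (?F Z)\<bar>
        \<le> (exp (2 * L * s) - 1) / 2 * D"
      by (simp add: integral_diff[OF int int])
    have "dist (\<Phi> Y t) (\<Phi> Z t)
        = exp (- 2 * L * s) * \<bar>integral {0..s} (?F Y) - integral {0..s} (?F Z)\<bar>"
      by (simp add: app H_def J_def dist_real_def abs_mult flip: s_def right_diff_distrib)
    also have "\<dots> \<le> exp (- 2 * L * s) * ((exp (2 * L * s) - 1) / 2 * D)"
      by (intro mult_left_mono *) auto
    also have "\<dots> = (1 - exp (- 2 * L * s)) / 2 * D"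
      by (simp add: field_simps exp_minus)
    also have "\<dots> \<le> 1/2 * D" using D by (intro mult_right_mono) auto
    finally show "dist (\<Phi> Y t) (\<Phi> Z t) \<le> 1/2 * dist Y Z" by (simp add: D_def)
  qed
  obtain Y where Y: "\<Phi> Y = Y"
    using banach_fix_type[of "1/2" \<Phi>] contr by auto
  define X where "X t = exp (2 * L * t) * Y t" for t
  have XJ: "X t = J X t" if "t \<in> {0..T}" for t
  proof -
    have "X t = exp (2 * L * t) * H Y t"
      using app[of Y] Y by (simp add: X_def)
    also have "\<dots> = J X t"
      unfolding H_def q_id[OF that] X_def[abs_def] by (simp add: exp_minus)
    finally show ?thesis .
  qed
  have cX: "continuous_on {0..T} X" unfolding X_def[abs_def] by (rule cont_w)
  show ?thesis
  proof (rule that[of X])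
    show "X 0 = x\<^sub>0" using XJ[of 0] T by (simp add: J_def)
    fix t assume t: "t \<in> {0..T}"
    have "(J X has_real_derivative F t (X t)) (at t within {0..T})"
      unfolding J_def[abs_def]
      by (auto intro!: derivative_eq_intros integral_has_real_derivative[OF cont_F[OF cX] t])
    then show "(X has_real_derivative F t (X t)) (at t within {0..T})"
      by (rule has_field_derivative_transform_within[where d = 1]) (use t XJ in auto)
  qed
qed

text \<open>Continuity of one partial derivative, here the spatial one, already makes
  \<open>f\<close> jointly differentiable at the point, and the chain rule applies. Taking all
  derivatives within \<open>S\<close> includes the one-sided ones at the ends of a time
  interval.\<close>

lemma has_real_derivative_along_curve:
  fixes f :: "real \<Rightarrow> real \<Rightarrow> real"
  assumes t: "t \<in> S"
    and ft: "((\<lambda>\<tau>. f \<tau> (X t)) has_real_derivative f') (at t within S)"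
    and fx: "\<And>\<tau> x. \<tau> \<in> S \<Longrightarrow> (f \<tau> has_real_derivative fx \<tau> x) (at x)"
    and cont: "continuous_on (S \<times> UNIV) (\<lambda>(\<tau>, x). fx \<tau> x)"
    and X: "(X has_real_derivative X') (at t within S)"
  shows "((\<lambda>\<tau>. f \<tau> (X \<tau>)) has_real_derivative f' + fx t (X t) * X') (at t within S)"
proof -
  have df: "((\<lambda>(\<tau>, x). f \<tau> x) has_derivative
      (\<lambda>(h, k). f' * h + blinfun_scaleR_left (fx t (X t)) k)) (at (t, X t) within S \<times> UNIV)"
  proof (rule has_derivative_partialsI[where fy = "\<lambda>\<tau> x. blinfun_scaleR_left (fx \<tau> x)",
        THEN has_derivative_eq_rhs])
    show "((\<lambda>\<tau>. f \<tau> (X t)) has_derivative (*) f') (at t within S)"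
      using ft by (simp add: has_field_derivative_def)
    show "(f \<tau> has_derivative blinfun_scaleR_left (fx \<tau> x)) (at x within UNIV)" 
      if "\<tau> \<in> S" for \<tau> x
      using fx[OF that] unfolding has_field_derivative_def
      by (rule has_derivative_eq_rhs) (auto simp: fun_eq_iff)
    have "((\<lambda>(\<tau>, x). fx \<tau> x) \<longlongrightarrow> fx t (X t)) (at (t, X t) within S \<times> UNIV)"
      using cont t by (auto simp: continuous_on_def)
    then have "((\<lambda>z. blinfun_scaleR_left (case z of (\<tau>, x) \<Rightarrow> fx \<tau> x)) \<longlongrightarrow>
        blinfun_scaleR_left (fx t (X t))) (at (t, X t) within S \<times> UNIV)"
      by (rule tendsto_intros)
    then show "continuous (at (t, X t) within S \<times> UNIV)
        (\<lambda>(\<tau>, x). blinfun_scaleR_left (fx \<tau> x))"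
      by (simp add: continuous_within case_prod_beta')
  qed (auto simp: fun_eq_iff)
  have "((\<lambda>\<tau>. (\<tau>, X \<tau>)) has_derivative (\<lambda>h. (h, X' * h))) (at t within S)"
    using X by (auto intro!: derivative_eq_intros simp: has_field_derivative_def)
  from has_derivative_in_compose[OF this has_derivative_subset[OF df]] t
  have "((\<lambda>\<tau>. (\<lambda>(\<tau>, x). f \<tau> x) (\<tau>, X \<tau>)) has_derivative
      (\<lambda>h. (\<lambda>(h, k). f' * h + blinfun_scaleR_left (fx t (X t)) k) (h, X' * h))) (at t within S)"
    by auto
  then show ?thesis
    unfolding has_field_derivative_def case_prod_conv
    by (rule has_derivative_eq_rhs) (auto simp: fun_eq_iff algebra_simps)
qed

text \<open>Formally this is the transport equation differentiated in \<open>x\<close>, but second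
  derivatives of \<open>f\<close> need not exist. Spatial difference quotients of \<open>f\<close>
  are differentiable along the curve, and their derivatives converge uniformly in time, so the limit
  may be differentiated.\<close>

lemma transport_space_derivative:
  fixes f l g :: "real \<Rightarrow> real \<Rightarrow> real"
  assumes ft: "\<And>t x. t \<in> {0..T} \<Longrightarrow> ((\<lambda>\<tau>. f \<tau> x) has_real_derivative ft t x) (at t within {0..T})"
    and fx: "\<And>t x. t \<in> {0..T} \<Longrightarrow> (f t has_real_derivative fx t x) (at x)"
    and lx: "\<And>t x. t \<in> {0..T} \<Longrightarrow> (l t has_real_derivative lx t x) (at x)"
    and gx: "\<And>t x. t \<in> {0..T} \<Longrightarrow> (g t has_real_derivative gx t x) (at x)"
    and cfx: "continuous_on ({0..T} \<times> UNIV) (\<lambda>(t, x). fx t x)"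
    and clx: "continuous_on ({0..T} \<times> UNIV) (\<lambda>(t, x). lx t x)"
    and cgx: "continuous_on ({0..T} \<times> UNIV) (\<lambda>(t, x). gx t x)"
    and eq: "\<And>t x. t \<in> {0..T} \<Longrightarrow> ft t x + l t x * fx t x = g t x"
    and X: "\<And>t. t \<in> {0..T} \<Longrightarrow> (X has_real_derivative l t (X t)) (at t within {0..T})"
    and t: "t \<in> {0..T}"
  shows "((\<lambda>\<tau>. fx \<tau> (X \<tau>)) has_real_derivative gx t (X t) - lx t (X t) * fx t (X t))
    (at t within {0..T})"
proof -
  define h where "h n = inverse (real (Suc n))" for n
  have h: "0 < h n" "h n \<le> 1" for n by (auto simp: h_def field_simps)
  have h_lim: "h \<longlonglongrightarrow> 0" unfolding h_def by (rule LIMSEQ_inverse_real_of_nat)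
  define D where "D n t = (f t (X t + h n) - f t (X t)) / h n" for n t
  \<comment> \<open>The equation at both points eliminates \<open>ft\<close>. The shifted point
    moves with the speed \<open>l t (X t)\<close> and not with its own, which leaves the difference
    quotient of \<open>l\<close>.\<close>
  define D' where "D' n t = (g t (X t + h n) - g t (X t)) / h n
      - (l t (X t + h n) - l t (X t)) / h n * fx t (X t + h n)" for n t
  \<comment> \<open>The mean value theorem writes \<open>D'\<close> as \<open>G\<close> at nearby
    points that differ for \<open>gx\<close> and \<open>lx\<close>, hence the separate spatial
    arguments. Uniform continuity of \<open>G\<close> on a compact set then gives uniform
    convergence.\<close>
  define G where "G = (\<lambda>(t, x, y, z). gx t x - lx t y * fx t z)"
  have der: "(D n has_real_derivative D' n t) (at t within {0..T})" if t: "t \<in> {0..T}" for n t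
  proof -
    have *: "((\<lambda>\<tau>. f \<tau> (X \<tau> + e)) has_real_derivative ft t (X t + e) + fx t (X t + e) * l t (X t))
        (at t within {0..T})" for e
      by (rule has_real_derivative_along_curve[where X = "\<lambda>\<tau>. X \<tau> + e", OF t ft[OF t] fx cfx])
        (auto intro!: derivative_eq_intros X t)
    have "(D n has_real_derivative (ft t (X t + h n) + fx t (X t + h n) * l t (X t)
        - (ft t (X t) + fx t (X t) * l t (X t))) / h n) (at t within {0..T})"
      unfolding D_def[abs_def]
      using *[of "h n"] *[of 0] by (intro DERIV_cdivide DERIV_diff) simp_all
    also have "ft t (X t + h n) + fx t (X t + h n) * l t (X t)
        - (ft t (X t) + fx t (X t) * l t (X t))
      = (g t (X t + h n) - g t (X t)) - (l t (X t + h n) - l t (X t)) * fx t (X t + h n)"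
      by (simp add: eq[OF t, symmetric] algebra_simps)
    finally show ?thesis by (simp add: D'_def diff_divide_distrib left_diff_distrib)
  qed
  have lim: "(\<lambda>n. D n t) \<longlonglongrightarrow> fx t (X t)" if t: "t \<in> {0..T}" for t
  proof -
    have "((\<lambda>e. (f t (X t + e) - f t (X t)) / e) \<longlongrightarrow> fx t (X t)) (at 0)"
      using fx[OF t] by (simp add: DERIV_def)
    moreover have "filterlim h (at 0) sequentially"
      using h h_lim by (auto simp: filterlim_at less_imp_neq[symmetric])
    ultimately show ?thesis unfolding D_def by (rule filterlim_compose)
  qed
  have "continuous_on {0..T} X"
    using X by (rule DERIV_continuous_on)
  then have "bounded (X ` {0..T})"
    by (intro compact_imp_bounded compact_continuous_image) auto
  then obtain R where R: "\<And>t. t \<in> {0..T} \<Longrightarrow> \<bar>X t\<bar> \<le> R"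
    by (force simp: bounded_iff)
  \<comment> \<open>Since \<open>h n \<le> 1\<close>, the shifted points exceed the bound
    \<open>R\<close> of the curve by at most 1.\<close>
  define I where "I = {- R..R + 1}"
  have cG: "continuous_on ({0..T} \<times> I \<times> I \<times> I) G"
  proof -
    have comp: "continuous_on ({0..T} \<times> I \<times> I \<times> I) (\<lambda>p. k (fst p) (\<pi> p))"
      if "continuous_on ({0..T} \<times> UNIV) (\<lambda>(t, x). k t x)"
        "continuous_on ({0..T} \<times> I \<times> I \<times> I) \<pi>"
      for k :: "real \<Rightarrow> real \<Rightarrow> real" and \<pi>
      by (rule continuous_on_compose2[OF that(1), of _ "\<lambda>p. (fst p, \<pi> p)", unfolded prod.case])
        (auto intro!: continuous_intros that(2))
    show ?thesis
      unfolding G_def case_prod_beta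
      by (intro continuous_on_diff continuous_on_mult comp[OF cfx] comp[OF clx] comp[OF cgx]
          continuous_intros)
  qed
  have unif: "uniformly_continuous_on ({0..T} \<times> I \<times> I \<times> I) G"
    by (rule compact_uniformly_continuous[OF cG]) (auto simp: I_def intro!: compact_Times)
  have conv: "\<forall>\<^sub>F n in sequentially. \<forall>t\<in>{0..T}. \<forall>k.
      norm (D' n t * k - (gx t (X t) - lx t (X t) * fx t (X t)) * k) \<le> e * norm k"
    if e: "0 < e" for e
  proof -
    obtain d where d: "0 < d" and close: "\<And>p q. p \<in> {0..T} \<times> I \<times> I \<times> I \<Longrightarrow>
        q \<in> {0..T} \<times> I \<times> I \<times> I \<Longrightarrow> dist q p < d \<Longrightarrow> dist (G q) (G p) < e"
      using unif e unfolding uniformly_continuous_on_def by metis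
    have "\<forall>\<^sub>F n in sequentially. h n < d / 3"
      using order_tendstoD(2)[OF h_lim, of "d / 3"] d by simp
    then show ?thesis
    proof eventually_elim
      case (elim n)
      have "\<bar>D' n t - (gx t (X t) - lx t (X t) * fx t (X t))\<bar> < e" if t: "t \<in> {0..T}" for t
      proof -
        have mvt: "\<exists>y. X t < y \<and> y < X t + h n \<and> (k t (X t + h n) - k t (X t)) / h n = kx t y"
          if k: "\<And>x. (k t has_real_derivative kx t x) (at x)" for k kx :: "real \<Rightarrow> real \<Rightarrow> real"
        proof -
          obtain y where "X t < y" "y < X t + h n"
            "k t (X t + h n) - k t (X t) = (X t + h n - X t) * kx t y"
            using MVT2[of "X t" "X t + h n" "k t" "kx t"] k h[of n] by auto
          then show ?thesis using h[of n] by (intro exI[of _ y]) auto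
        qed
        obtain y where y: "X t < y" "y < X t + h n"
          "(g t (X t + h n) - g t (X t)) / h n = gx t y" using mvt gx[OF t] by blast
        obtain z where z: "X t < z" "z < X t + h n"
          "(l t (X t + h n) - l t (X t)) / h n = lx t z" using mvt lx[OF t] by blast
        have "dist (t, y, z, X t + h n) (t, X t, X t, X t)
            = sqrt (\<bar>y - X t\<bar>\<^sup>2 + (sqrt (\<bar>z - X t\<bar>\<^sup>2 + \<bar>h n\<bar>\<^sup>2))\<^sup>2)"
          by (simp add: dist_Pair_Pair dist_real_def)
        also have "\<dots> \<le> \<bar>y - X t\<bar> + (\<bar>z - X t\<bar> + \<bar>h n\<bar>)"
          by (intro order_trans[OF sqrt_sum_squares_le_sum] add_mono sqrt_sum_squares_le_sum) auto
        also have "\<dots> < d" using y z h[of n] elim by auto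
        finally have "dist (G (t, y, z, X t + h n)) (G (t, X t, X t, X t)) < e"
          using R[OF t] t y z h[of n] by (intro close) (auto simp: I_def)
        then show ?thesis by (simp add: G_def D'_def y z dist_real_def)
      qed
      then have "\<bar>D' n t - (gx t (X t) - lx t (X t) * fx t (X t))\<bar> * \<bar>k\<bar> \<le> e * \<bar>k\<bar>"
        if "t \<in> {0..T}" for t k
        using that by (intro mult_right_mono) (auto intro: less_imp_le)
      then show ?case
        by (simp add: abs_mult flip: left_diff_distrib)
    qed
  qed
  \<comment> \<open>Uniform convergence of the derivatives lets limit and derivative be exchanged;
    the limit \<open>w\<close> is then recognised as \<open>fx\<close> along the curve.\<close>
  have "\<exists>w. \<forall>t\<in>{0..T}. (\<lambda>n. D n t) \<longlonglongrightarrow> w t \<and>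
      (w has_derivative (*) (gx t (X t) - lx t (X t) * fx t (X t))) (at t within {0..T})"
    using der lim[OF t] conv
    by (intro has_derivative_sequence[where f' = "\<lambda>n t. (*) (D' n t)" and ?x0.0 = t])
      (use t in \<open>auto simp: has_field_derivative_def\<close>)
  then obtain w where w: "\<And>t. t \<in> {0..T} \<Longrightarrow> (\<lambda>n. D n t) \<longlonglongrightarrow> w t"
    "\<And>t. t \<in> {0..T} \<Longrightarrow>
      (w has_real_derivative gx t (X t) - lx t (X t) * fx t (X t)) (at t within {0..T})"
    unfolding has_field_derivative_def by blast
  have "w t = fx t (X t)" if "t \<in> {0..T}" for t
    using LIMSEQ_unique[OF w(1) lim] that by blast
  then show ?thesis
    by (intro has_field_derivative_transform_within[OF w(2)[OF t], of 1]) (use t in auto)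
qed

subsection \<open>The maximum principle\<close>

text \<open>The barrier \<open>\<psi>\<close> satisfies \<open>\<psi>\<^sub>t > C |\<psi>\<^sub>x|\<close>, so no transport with speed at most \<open>C\<close> can keep
  up with it at an interior maximum of \<open>f - \<psi>\<close>.\<close>

lemma barrier_maximum:
  fixes f :: "real \<Rightarrow> real \<Rightarrow> real"
  defines "\<psi> \<equiv> \<lambda>C \<kappa> t x. \<kappa> * exp ((C + 1) * t) * (1 + x\<^sup>2)"
  assumes ft: "((\<lambda>\<tau>. f \<tau> y) has_real_derivative ft) (at s within {0..T})"
    and fx: "(f s has_real_derivative fx) (at y)"
    and c: "\<bar>c\<bar> \<le> C" and \<kappa>: "0 < \<kappa>" and s: "0 < s" "s \<le> T"
    and max: "\<And>t x. t \<in> {0..T} \<Longrightarrow> f t x - \<psi> C \<kappa> t x \<le> f s y - \<psi> C \<kappa> s y"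
  shows "0 < ft + c * fx"
proof -
  define E where "E = \<kappa> * exp ((C + 1) * s)"
  have E: "0 < E" using \<kappa> by (simp add: E_def)
  have "((\<lambda>x. f s x - \<psi> C \<kappa> s x) has_real_derivative fx - E * (2 * y)) (at y)"
    unfolding \<psi>_def E_def using fx by (auto intro!: derivative_eq_intros)
  then have fx_eq: "fx = E * (2 * y)"
    using DERIV_local_max[of "\<lambda>x. f s x - \<psi> C \<kappa> s x" "fx - E * (2 * y)" y 1] max s by auto
  have d: "((\<lambda>t. f t y - \<psi> C \<kappa> t y) has_real_derivative ft - (C + 1) * E * (1 + y\<^sup>2))
      (at s within {0..T})"
    unfolding \<psi>_def E_def using ft by (auto intro!: derivative_eq_intros)
  \<comment> \<open>As \<open>s\<close> may be the final time, the comparison is with earlier times: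
    with a smaller time derivative, \<open>f - \<psi>\<close> would be larger just before
    \<open>s\<close>.\<close>
  have "(C + 1) * E * (1 + y\<^sup>2) \<le> ft"
  proof (rule ccontr)
    assume "\<not> ?thesis"
    then obtain d where "0 < d" and
      d: "\<And>h. 0 < h \<Longrightarrow> s - h \<in> {0..T} \<Longrightarrow> h < d \<Longrightarrow> f s y - \<psi> C \<kappa> s y < f (s - h) y - \<psi> C \<kappa> (s - h) y"
      using has_real_derivative_neg_dec_left[OF d] by auto
    define h where "h = min (d / 2) s"
    have "0 < h" "h \<le> s" "h < d" using s \<open>0 < d\<close> by (auto simp: h_def min_def)
    then show False using d[of h] max[of "s - h" y] s by auto
  qed
  moreover have "\<bar>c * fx\<bar> \<le> C * E * (1 + y\<^sup>2)"
  proof -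
    \<comment> \<open>This is why the barrier grows like \<open>1 + x\<^sup>2\<close>: its slope is
      controlled by the barrier itself. The extra 1 in \<open>C + 1\<close> then makes the final
      inequality strict.\<close>
    have "2 * \<bar>y\<bar> \<le> 1 + y\<^sup>2"
      using zero_le_power2[of "\<bar>y\<bar> - 1"] by (simp add: power2_diff)
    then have "\<bar>c\<bar> * (E * (2 * \<bar>y\<bar>)) \<le> C * (E * (1 + y\<^sup>2))"
      using c E by (intro mult_mono mult_left_mono) auto
    then show ?thesis using E by (simp add: fx_eq abs_mult mult.assoc)
  qed
  moreover have "0 < E * (1 + y\<^sup>2)"
    using E by (simp add: add_pos_nonneg)
  ultimately show ?thesis by (simp add: algebra_simps abs_le_iff)
qed

text \<open>At a maximum of \<open>max f g - \<psi>\<close>, the larger of the two functions, say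
  \<open>f\<close>, has the nonpositive right-hand side \<open>b * (g - f)\<close>, whereas the
  barrier forces a strictly positive one. The bound \<open>B\<close> confines the search for a
  maximum to a compact set.\<close>

lemma coupled_transport_upper_bound:
  fixes f g :: "real \<Rightarrow> real \<Rightarrow> real"
  assumes ft: "\<And>t x. t \<in> {0..T} \<Longrightarrow> ((\<lambda>\<tau>. f \<tau> x) has_real_derivative ft t x) (at t within {0..T})"
    and fx: "\<And>t x. t \<in> {0..T} \<Longrightarrow> (f t has_real_derivative fx t x) (at x)"
    and gt: "\<And>t x. t \<in> {0..T} \<Longrightarrow> ((\<lambda>\<tau>. g \<tau> x) has_real_derivative gt t x) (at t within {0..T})"
    and gx: "\<And>t x. t \<in> {0..T} \<Longrightarrow> (g t has_real_derivative gx t x) (at x)"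
    and cf: "continuous_on ({0..T} \<times> UNIV) (\<lambda>(t, x). f t x)"
    and cg: "continuous_on ({0..T} \<times> UNIV) (\<lambda>(t, x). g t x)"
    and eqf: "\<And>t x. t \<in> {0..T} \<Longrightarrow> ft t x + c\<^sub>1 t x * fx t x = b t x * (g t x - f t x)"
    and eqg: "\<And>t x. t \<in> {0..T} \<Longrightarrow> gt t x + c\<^sub>2 t x * gx t x = b t x * (f t x - g t x)"
    and b: "\<And>t x. t \<in> {0..T} \<Longrightarrow> 0 \<le> b t x"
    and c: "\<And>t x. t \<in> {0..T} \<Longrightarrow> \<bar>c\<^sub>1 t x\<bar> \<le> C" "\<And>t x. t \<in> {0..T} \<Longrightarrow> \<bar>c\<^sub>2 t x\<bar> \<le> C"
    and B: "\<And>t x. t \<in> {0..T} \<Longrightarrow> max (f t x) (g t x) \<le> B"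
    and init: "\<And>x. max (f 0 x) (g 0 x) \<le> M"
    and t: "t \<in> {0..T}"
  shows "max (f t x) (g t x) \<le> M"
proof (rule ccontr)
  define m where "m t x = max (f t x) (g t x)" for t x
  assume "\<not> ?thesis"
  then have gap: "0 < m t x - M" by (simp add: m_def del: max.bounded_iff)
  \<comment> \<open>With this scale the barrier takes away exactly half of the assumed excess over
    \<open>M\<close> at the given point.\<close>
  define \<kappa> where "\<kappa> = (m t x - M) / (2 * (exp ((C + 1) * t) * (1 + x\<^sup>2)))"
  have pos: "0 < exp ((C + 1) * t) * (1 + x\<^sup>2)" by (simp add: add_pos_nonneg)
  have \<kappa>: "0 < \<kappa>" using gap pos by (simp add: \<kappa>_def)
  define \<psi> where "\<psi> t x = \<kappa> * exp ((C + 1) * t) * (1 + x\<^sup>2)" for t x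
  have "\<psi> t x = (m t x - M) / 2"
    using pos unfolding \<psi>_def \<kappa>_def by (simp add: field_simps)
  then have start: "M < m t x - \<psi> t x" using gap by simp
  have C: "0 \<le> C" using c(1)[OF t, of x] by simp
  have \<psi>: "\<kappa> * (1 + x\<^sup>2) \<le> \<psi> t x" if "t \<in> {0..T}" for t x
  proof -
    have "\<kappa> * (1 + x\<^sup>2) * 1 \<le> \<kappa> * (1 + x\<^sup>2) * exp ((C + 1) * t)"
      using \<kappa> C that by (intro mult_left_mono) auto
    then show ?thesis by (simp add: \<psi>_def mult_ac)
  qed
  \<comment> \<open>Beyond \<open>R\<close> the barrier is at least \<open>B - M\<close>, so
    \<open>m - \<psi>\<close> is at most \<open>M\<close> there, less than at the given point. A
    maximum over the rectangle is therefore a maximum over the whole strip.\<close>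
  define R where "R = \<bar>x\<bar> + 1 + \<bar>B - M\<bar> / \<kappa>"
  have R: "1 \<le> R" "\<bar>B - M\<bar> / \<kappa> \<le> R" "\<bar>x\<bar> \<le> R" using \<kappa> by (auto simp: R_def)
  define K where "K = {0..T} \<times> {- R..R}"
  have "continuous_on K (\<lambda>p. m (fst p) (snd p) - \<psi> (fst p) (snd p))"
    unfolding m_def \<psi>_def
    using continuous_on_subset[OF cf, of K] continuous_on_subset[OF cg, of K]
    by (auto simp: K_def case_prod_beta intro!: continuous_intros)
  moreover have "compact K" "(t, x) \<in> K"
    using t R by (auto simp: K_def intro!: compact_Times)
  ultimately have "\<exists>p\<in>K. \<forall>q\<in>K. m (fst q) (snd q) - \<psi> (fst q) (snd q)
      \<le> m (fst p) (snd p) - \<psi> (fst p) (snd p)"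
    by (intro continuous_attains_sup) auto
  then obtain p where p: "p \<in> K" and
    pmax: "\<And>q. q \<in> K \<Longrightarrow> m (fst q) (snd q) - \<psi> (fst q) (snd q) \<le> m (fst p) (snd p) - \<psi> (fst p) (snd p)"
    by blast
  obtain s y where [simp]: "p = (s, y)" by (cases p)
  have s: "s \<in> {0..T}" using p by (simp add: K_def)
  have larger: "M < m s y - \<psi> s y"
    using start pmax[OF \<open>(t, x) \<in> K\<close>] by simp
  have global: "m \<tau> z - \<psi> \<tau> z \<le> m s y - \<psi> s y" if \<tau>: "\<tau> \<in> {0..T}" for \<tau> z
  proof (cases "\<bar>z\<bar> \<le> R")
    case True
    then have "(\<tau>, z) \<in> K" using \<tau> by (simp add: K_def abs_le_iff)
    then show ?thesis using pmax[of "(\<tau>, z)"] by simp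
  next
    case False
    have "B - M \<le> \<kappa> * R"
      using R \<kappa> by (simp add: divide_le_eq mult.commute)
    also have "\<dots> \<le> \<kappa> * (1 + z\<^sup>2)"
    proof -
      have "R \<le> R * R" using R by simp
      also have "\<dots> \<le> z\<^sup>2" using False R abs_le_square_iff[of R z] by (auto simp: power2_eq_square)
      finally show ?thesis using \<kappa> by auto
    qed
    also have "\<dots> \<le> \<psi> \<tau> z" by (rule \<psi>[OF \<tau>])
    finally have "B - M \<le> \<psi> \<tau> z" .
    moreover have "m \<tau> z \<le> B" unfolding m_def by (rule B[OF \<tau>])
    ultimately show ?thesis using larger by linarith
  qed
  have "0 < \<psi> s y" using \<psi>[OF s, of y] \<kappa> by (smt (verit) mult_pos_pos zero_le_power2)
  then have "s \<noteq> 0" using larger init[of y] by (auto simp: m_def)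
  then have s': "0 < s" "s \<le> T" using s by auto
  have below_f: "f \<tau> z - \<psi> \<tau> z \<le> f s y - \<psi> s y" if "\<tau> \<in> {0..T}" "g s y \<le> f s y" for \<tau> z
    using global[OF that(1), of z] that(2) unfolding m_def by linarith
  have below_g: "g \<tau> z - \<psi> \<tau> z \<le> g s y - \<psi> s y" if "\<tau> \<in> {0..T}" "f s y \<le> g s y" for \<tau> z
    using global[OF that(1), of z] that(2) unfolding m_def by linarith
  show False
  proof (cases "g s y \<le> f s y")
    case True
    have "0 < ft s y + c\<^sub>1 s y * fx s y"
      by (rule barrier_maximum[where \<kappa> = \<kappa> and C = C, OF ft[OF s] fx[OF s] c(1)[OF s] \<kappa> s'])
        (unfold \<psi>_def[symmetric], use below_f True in blast)
    then show False using eqf[OF s, of y] b[OF s, of y] True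
      by (smt (verit) mult_nonneg_nonpos)
  next
    case False
    have "0 < gt s y + c\<^sub>2 s y * gx s y"
      by (rule barrier_maximum[where \<kappa> = \<kappa> and C = C, OF gt[OF s] gx[OF s] c(2)[OF s] \<kappa> s'])
        (unfold \<psi>_def[symmetric], use below_g False in force)
    then show False using eqg[OF s, of y] b[OF s, of y] False
      by (smt (verit) mult_nonneg_nonpos)
  qed
qed

subsection \<open>Riccati inequalities\<close>

text \<open>While \<open>z\<close> lies below \<open>- N\<close> it does not increase, so it stays
  there, and \<open>- 1 / z\<close> falls at rate at least \<open>k\<close>. It starts below
  \<open>1 / N\<close> and would have to be negative by time \<open>T\<close>, although
  \<open>z\<close> is negative.\<close>

lemma riccati_blowup:
  fixes z z' :: "real \<Rightarrow> real"
  assumes z: "\<And>t. t \<in> {0..T} \<Longrightarrow> (z has_real_derivative z' t) (at t within {0..T})"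
    and pos: "0 < N" "0 < k" "0 < T" and long: "1 \<le> k * N * T"
    and init: "z 0 < - N"
    and ineq: "\<And>t. t \<in> {0..T} \<Longrightarrow> z t < - N \<Longrightarrow> z' t \<le> - k * (z t)\<^sup>2"
  shows False
proof -
  have cont: "continuous_on {0..T} z"
    using z by (rule DERIV_continuous_on)
  have interior: "(z has_real_derivative z' t) (at t)" if "0 < t" "t < T" for t
    using z[of t] that by (simp add: at_within_Icc_at)
  have below: "z t < - N" if t: "t \<in> {0..T}" for t
  proof (rule ccontr)
    \<comment> \<open>Before the first time at which \<open>z\<close> reaches \<open>- N\<close> the
      inequality makes \<open>z\<close> nonincreasing, so at that time \<open>z\<close> is still at
      most \<open>z 0\<close>, a contradiction.\<close>
    assume "\<not> z t < - N"
    define S where "S = {t \<in> {0..T}. - N \<le> z t}"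
    have "S = {0..T} \<inter> z -` {- N..}" by (auto simp: S_def)
    then have "closed S" using continuous_closed_preimage[OF cont] by simp
    moreover have "S \<noteq> {}" "bdd_below S"
      using t \<open>\<not> z t < - N\<close> by (auto simp: S_def intro!: bdd_belowI)
    ultimately have s: "Inf S \<in> S" by (rule closed_contains_Inf[rotated 2])
    define s where "s = Inf S"
    have before: "z t < - N" if "0 \<le> t" "t < s" for t
    proof (rule ccontr)
      assume "\<not> z t < - N"
      then have "t \<in> S" using that s by (auto simp: S_def s_def)
      then show False using cInf_lower[of t S] \<open>bdd_below S\<close> that by (simp add: s_def)
    qed
    have "z s \<le> z 0"
    proof (rule DERIV_nonpos_imp_decreasing_open[where f = z])
      show "0 \<le> s" using s by (simp add: S_def s_def)
      show "continuous_on {0..s} z"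
        by (rule continuous_on_subset[OF cont]) (use s in \<open>auto simp: S_def s_def\<close>)
      fix t assume "0 < t" "t < s"
      moreover from this have "t < T" using s by (simp add: S_def s_def)
      moreover have "z' t \<le> 0"
        using ineq[of t] before[of t] calculation pos
        by (smt (verit) atLeastAtMost_iff mult_nonneg_nonneg zero_le_power2 mult_minus_left)
      ultimately show "\<exists>y. (z has_real_derivative y) (at t) \<and> y \<le> 0"
        using interior by blast
    qed
    then show False using s init by (simp add: S_def s_def)
  qed
  have "k * T - 1 / z T \<le> k * 0 - 1 / z 0"
  proof (rule DERIV_nonpos_imp_decreasing_open[where f = "\<lambda>t. k * t - 1 / z t"])
    show "0 \<le> T" using pos by simp
    have "z t \<noteq> 0" if "t \<in> {0..T}" for t using below[OF that] pos by auto
    then show "continuous_on {0..T} (\<lambda>t. k * t - 1 / z t)"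
      by (intro continuous_intros cont) auto
    fix t assume t: "0 < t" "t < T"
    then have "z t < - N" using below[of t] by simp
    then have "z t \<noteq> 0" using pos by auto
    have "((\<lambda>t. k * t - 1 / z t) has_real_derivative k + z' t / (z t)\<^sup>2) (at t)"
      using interior[OF t] \<open>z t \<noteq> 0\<close>
      by (auto intro!: derivative_eq_intros simp: power2_eq_square)
    moreover have "k + z' t / (z t)\<^sup>2 \<le> 0"
      using ineq[of t] t \<open>z t < - N\<close> \<open>z t \<noteq> 0\<close> by (simp add: field_simps)
    ultimately show "\<exists>y. ((\<lambda>t. k * t - 1 / z t) has_real_derivative y) (at t) \<and> y \<le> 0" by blast
  qed
  moreover have "- 1 / z 0 < 1 / N" using init pos by (simp add: field_simps)
  moreover have "0 < - 1 / z T" using below[of T] pos by (simp add: field_simps)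
  moreover have "1 / N \<le> k * T" using long pos by (simp add: field_simps)
  ultimately show False by simp
qed

text \<open>For such \<open>z\<close> and \<open>w = - z\<close>, the value \<open>- y\<close> lies
  between \<open>w / 2\<close> and \<open>3 / 2 * w\<close>. The quadratic term then gains
  \<open>k * w\<^sup>2 / 4\<close>, while the thresholds with 24 and 16 are those at which the
  linear and the constant term each cost at most \<open>k * w\<^sup>2 / 16\<close>.\<close>

lemma quadratic_dominates:
  fixes y e z k \<kappa> \<alpha> q :: real
  assumes k: "0 < k" "k \<le> \<kappa>" and z: "z = y + e" and e: "\<bar>e\<bar> \<le> E"
    and \<alpha>: "0 \<le> \<alpha>" "\<alpha> \<le> A" and q: "\<bar>q\<bar> \<le> Q"
    and large: "z < - (1 + 2 * E + 24 * A / k + 16 * Q / k)"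
  shows "- \<kappa> * y\<^sup>2 - \<alpha> * y + q \<le> - (k / 8) * z\<^sup>2"
proof -
  have nonneg: "0 \<le> E" "0 \<le> A" "0 \<le> Q" using e \<alpha> q by auto
  then have "0 \<le> 24 * A / k" "0 \<le> 16 * Q / k" using k by auto
  with large nonneg have size: "1 \<le> - z" "2 * E \<le> - z" "24 * A / k \<le> - z" "16 * Q / k \<le> - z"
    by linarith+
  define w where "w = - z"
  have w: "1 \<le> w" "2 * E \<le> w" "24 * A \<le> k * w" "16 * Q \<le> k * w"
    using size k by (auto simp: w_def field_simps)
  have y: "w / 2 \<le> - y" "- y \<le> 3 / 2 * w"
    using z e w by (auto simp: w_def)
  have "(w / 2)\<^sup>2 \<le> (- y)\<^sup>2" using y w by (intro power_mono) auto
  then have "k * (w\<^sup>2 / 4) \<le> \<kappa> * y\<^sup>2"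
    using k by (intro mult_mono) (auto simp: power_divide)
  moreover have "\<alpha> * (- y) \<le> A * (3 / 2 * w)"
    using y w \<alpha> by (intro mult_mono) auto
  moreover have "A * (3 / 2 * w) \<le> k * w / 24 * (3 / 2 * w)"
    using w by (intro mult_right_mono) auto
  moreover have "k * w * 1 \<le> k * w * w"
    using k w by (intro mult_left_mono) auto
  ultimately show ?thesis
    using q w(4) by (simp add: w_def power2_eq_square)
qed

subsection \<open>The damped p-system\<close>

text \<open>Powers are monotone in the base, in a direction given by the sign of \<open>q\<close>;
  the sum of the two end values covers both signs.\<close>

lemma powr_le_endpoints:
  fixes d u m q :: real
  assumes "0 < d" "d \<le> u" "u \<le> m"
  shows "u powr q \<le> d powr q + m powr q"
proof (cases "0 \<le> q")
  case True
  then have "u powr q \<le> m powr q" using assms by (intro powr_mono2) auto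
  then show ?thesis by (simp add: add_increasing)
next
  case False
  then have "u powr q \<le> d powr q" using assms by (intro powr_mono2') auto
  then show ?thesis by (simp add: add_increasing2)
qed

text \<open>The two powers are decreasing and inverse to each other. This converts bounds on
  \<open>p'(u)\<close> and on \<open>\<eta>(u)\<close> into bounds on \<open>u\<close>.\<close>

lemma powr_uminus_le_iff:
  fixes u y q :: real
  assumes "0 < u" "0 < y" "0 < q"
  shows "u powr (- q) \<le> y \<longleftrightarrow> y powr (- 1 / q) \<le> u"
    and "y \<le> u powr (- q) \<longleftrightarrow> u \<le> y powr (- 1 / q)"
proof -
  have inv: "(u powr (- q)) powr (- 1 / q) = u" "(y powr (- 1 / q)) powr (- q) = y"
    using assms by (simp_all add: powr_powr)
  have le: "w powr r \<le> z powr r" if "z \<le> w" "0 < z" "r < 0" for w z r :: real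
    using that by (intro powr_mono2') auto
  have neg: "- 1 / q < 0" "- q < 0" and pos: "0 < u powr (- q)" "0 < y powr (- 1 / q)"
    using assms by auto
  show "u powr (- q) \<le> y \<longleftrightarrow> y powr (- 1 / q) \<le> u"
    using le[OF _ pos(1) neg(1), of y] le[OF _ pos(2) neg(2), of u] unfolding inv by blast
  show "y \<le> u powr (- q) \<longleftrightarrow> u \<le> y powr (- 1 / q)"
    using le[OF _ assms(2) neg(1), of "u powr (- q)"] le[OF _ assms(1) neg(2), of "y powr (- 1 / q)"]
    unfolding inv by blast
qed

lemma eta_has_real_derivative:
  assumes "1 < \<gamma>" "0 < u"
  shows "(eta \<gamma> has_real_derivative - (u powr (- (\<gamma> + 1) / 2))) (at u)"
proof (rule has_field_derivative_transform_within_open[where S = "{0<..}"])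
  define p where "p = - (\<gamma> - 1) / 2"
  have p: "2 / (\<gamma> - 1) * p = - 1" "- (\<gamma> + 1) / 2 = p - 1"
    using assms by (auto simp: p_def field_simps)
  have "((\<lambda>u. 2 / (\<gamma> - 1) * u powr p) has_real_derivative
      2 / (\<gamma> - 1) * (p * u powr (p - 1))) (at u)"
    using assms by (intro DERIV_cmult has_real_derivative_powr) auto
  also have "2 / (\<gamma> - 1) * (p * u powr (p - 1)) = - (u powr (- (\<gamma> + 1) / 2))"
    unfolding p(2) mult.assoc[symmetric] p(1) by simp
  finally show "((\<lambda>u. 2 / (\<gamma> - 1) * u powr (- (\<gamma> - 1) / 2)) has_real_derivative
      - (u powr (- (\<gamma> + 1) / 2))) (at u)"
    by (simp add: p_def)
qed (use assms in \<open>auto simp: eta_eq\<close>)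

lemma pressure_has_real_derivative:
  assumes "1 < \<gamma>" "0 < u"
  shows "(pressure \<gamma> has_real_derivative - (u powr (- (\<gamma> + 1)))) (at u)"
proof -
  have "(pressure \<gamma> has_real_derivative - \<gamma> * u powr (- \<gamma> - 1) / \<gamma>) (at u)"
    unfolding pressure_def[abs_def]
    using assms by (intro DERIV_cdivide has_real_derivative_powr) auto
  then have "(pressure \<gamma> has_real_derivative - (u powr (- \<gamma> - 1))) (at u)"
    using assms by simp
  moreover have exponent: "- \<gamma> - 1 = - (\<gamma> + 1)" by simp
  ultimately show ?thesis unfolding exponent by blast
qed

section \<open>Partial derivatives of C1 functions on a time strip\<close>

lemma C1_on_subset: "C1_on I f \<Longrightarrow> J \<subseteq> I \<Longrightarrow> C1_on J f"
  unfolding C1_on_def by (blast intro: continuous_on_subset)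

lemma C1_on_dt:
  assumes "C1_on I f" "t \<in> I" "S \<subseteq> {0..}"
  shows "((\<lambda>\<tau>. f \<tau> x) has_real_derivative dt f t x) (at t within S)"
proof -
  have "((\<lambda>\<tau>. f \<tau> x) has_vector_derivative dt f t x) (at t within {0..})"
    using assms unfolding dt_def C1_on_def by (auto simp flip: vector_derivative_works)
  then show ?thesis
    using assms(3)
    by (simp add: has_real_derivative_iff_has_vector_derivative has_vector_derivative_within_subset)
qed

lemma C1_on_dx:
  assumes "C1_on I f" "t \<in> I"
  shows "(f t has_real_derivative dx f t x) (at x)"
  using assms unfolding dx_def C1_on_def
  by (auto simp: DERIV_deriv_iff_real_differentiable)

lemma C1_on_continuous:
  assumes "C1_on I f"
  shows "continuous_on (I \<times> UNIV) (\<lambda>(t, x). f t x)"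
    and "continuous_on (I \<times> UNIV) (\<lambda>(t, x). dx f t x)"
  using assms by (auto simp: C1_on_def)

text \<open>The constants \<open>d\<close> and \<open>B\<close> come from the individual solution on
  a closed time interval. They make wave speeds finite and characteristics global; the final bounds
  are independent of them.\<close>

locale damped_p_system =
  fixes \<gamma> T d B :: real and a u v :: "real \<Rightarrow> real \<Rightarrow> real"
  assumes gamma: "1 < \<gamma>" and T: "0 \<le> T" and d: "0 < d"
    and C1_a: "C1_on {0..T} a" and C1_u: "C1_on {0..T} u" and C1_v: "C1_on {0..T} v"
    and a_nonneg: "\<And>t x. t \<in> {0..T} \<Longrightarrow> 0 \<le> a t x"
    and u_lower: "\<And>t x. t \<in> {0..T} \<Longrightarrow> d \<le> u t x"
    and u_upper: "\<And>t x. t \<in> {0..T} \<Longrightarrow> u t x \<le> B"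
    and v_bound: "\<And>t x. t \<in> {0..T} \<Longrightarrow> \<bar>v t x\<bar> \<le> B"
    and ux_bound: "\<And>t x. t \<in> {0..T} \<Longrightarrow> \<bar>dx u t x\<bar> \<le> B"
    and mass: "\<And>t x. t \<in> {0..T} \<Longrightarrow> dt u t x = dx v t x"
    and momentum: "\<And>t x. t \<in> {0..T} \<Longrightarrow>
      dt v t x + dx (\<lambda>t x. pressure \<gamma> (u t x)) t x = - a t x * v t x"
begin

definition c :: "real \<Rightarrow> real \<Rightarrow> real" where
  "c t x = u t x powr (- (\<gamma> + 1) / 2)"

text \<open>The sign \<sigma> treats both invariants at once: 1 gives \<open>s\<close> and -1 gives
  \<open>r\<close>, and the corresponding wave speed is \<open>\<sigma> * c\<close>.\<close>

definition riemann :: "real \<Rightarrow> real \<Rightarrow> real \<Rightarrow> real" where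
  "riemann \<sigma> t x = v t x + \<sigma> * eta \<gamma> (u t x)"

definition riemann_x :: "real \<Rightarrow> real \<Rightarrow> real \<Rightarrow> real" where
  "riemann_x \<sigma> t x = dx v t x - \<sigma> * c t x * dx u t x"

definition c_x :: "real \<Rightarrow> real \<Rightarrow> real" where
  "c_x t x = - ((\<gamma> + 1) / 2 * u t x powr (- (\<gamma> + 1) / 2 - 1) * dx u t x)"

lemma u_pos: "t \<in> {0..T} \<Longrightarrow> 0 < u t x"
  using u_lower d by (rule less_le_trans[rotated])

lemma time_subset: "{0..T} \<subseteq> {0..}" by auto

lemmas u_t = C1_on_dt[OF C1_u _ time_subset]
  and v_t = C1_on_dt[OF C1_v _ time_subset]
  and a_t = C1_on_dt[OF C1_a _ time_subset]
lemmas u_x = C1_on_dx[OF C1_u] and v_x = C1_on_dx[OF C1_v] and a_x = C1_on_dx[OF C1_a]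

lemma continuous_u:
  "continuous_on ({0..T} \<times> UNIV) (\<lambda>p. u (fst p) (snd p))"
  "continuous_on ({0..T} \<times> UNIV) (\<lambda>p. dx u (fst p) (snd p))"
  using C1_on_continuous[OF C1_u] by (simp_all add: case_prod_beta)

lemma continuous_v:
  "continuous_on ({0..T} \<times> UNIV) (\<lambda>p. v (fst p) (snd p))"
  "continuous_on ({0..T} \<times> UNIV) (\<lambda>p. dx v (fst p) (snd p))"
  using C1_on_continuous[OF C1_v] by (simp_all add: case_prod_beta)

lemma continuous_a:
  "continuous_on ({0..T} \<times> UNIV) (\<lambda>p. a (fst p) (snd p))"
  "continuous_on ({0..T} \<times> UNIV) (\<lambda>p. dx a (fst p) (snd p))"
  using C1_on_continuous[OF C1_a] by (simp_all add: case_prod_beta)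

lemma continuous_u_powr: "continuous_on ({0..T} \<times> UNIV) (\<lambda>p. u (fst p) (snd p) powr q)"
  using u_pos by (intro continuous_on_powr continuous_on_const continuous_u) (auto simp: less_imp_neq[symmetric])

lemma continuous_c: "continuous_on ({0..T} \<times> UNIV) (\<lambda>p. c (fst p) (snd p))"
  unfolding c_def by (rule continuous_u_powr)

lemma c_has_derivative:
  assumes "t \<in> {0..T}"
  shows "(c t has_real_derivative c_x t x) (at x)"
  unfolding c_def[abs_def] c_x_def
  using u_pos[OF assms, of x]
  by (auto intro!: derivative_eq_intros u_x assms simp: field_simps)

lemma riemann_derivatives:
  assumes t: "t \<in> {0..T}"
  shows "((\<lambda>\<tau>. riemann \<sigma> \<tau> x) has_real_derivative dt v t x - \<sigma> * c t x * dt u t x)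
      (at t within {0..T})"
    and "(riemann \<sigma> t has_real_derivative riemann_x \<sigma> t x) (at x)"
proof -
  have eta: "((\<lambda>z. \<sigma> * eta \<gamma> (k z)) has_real_derivative \<sigma> * (- c t x * k')) (at y within S)"
    if "(k has_real_derivative k') (at y within S)" "k y = u t x" for k k' y S
    unfolding c_def
    by (rule DERIV_cmult, rule DERIV_chain2[where f = "eta \<gamma>", rotated])
      (use that eta_has_real_derivative[OF gamma u_pos[OF t, of x]] in auto)
  show "((\<lambda>\<tau>. riemann \<sigma> \<tau> x) has_real_derivative dt v t x - \<sigma> * c t x * dt u t x)
      (at t within {0..T})"
    unfolding riemann_def using DERIV_add[OF v_t[OF t, of x] eta[OF u_t[OF t] refl]]
    by (simp add: mult.assoc)
  show "(riemann \<sigma> t has_real_derivative riemann_x \<sigma> t x) (at x)"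
    unfolding riemann_def[abs_def] riemann_x_def
    using DERIV_add[OF v_x[OF t, of x] eta[OF u_x[OF t] refl]] by (simp add: mult.assoc)
qed

text \<open>Since \<open>p'(u) = - c\<^sup>2\<close>, the terms with \<open>u\<^sub>x\<close> cancel
  by \<open>\<sigma> * \<sigma> = 1\<close>, and those with \<open>v\<^sub>x\<close> cancel by
  conservation of mass.\<close>

lemma riemann_equation:
  assumes t: "t \<in> {0..T}" and \<sigma>: "\<sigma> * \<sigma> = 1"
  shows "dt v t x - \<sigma> * c t x * dt u t x + \<sigma> * c t x * riemann_x \<sigma> t x = - a t x * v t x"
proof -
  have "((\<lambda>x. pressure \<gamma> (u t x)) has_real_derivative
      - (u t x powr (- (\<gamma> + 1))) * dx u t x) (at x)"
    by (rule DERIV_chain2[OF pressure_has_real_derivative u_x]) (use gamma u_pos t in auto)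
  then have "dx (\<lambda>t x. pressure \<gamma> (u t x)) t x = - (u t x powr (- (\<gamma> + 1))) * dx u t x"
    unfolding dx_def by (rule DERIV_imp_deriv)
  moreover have "u t x powr (- (\<gamma> + 1)) = c t x * c t x"
    unfolding c_def by (simp flip: powr_add)
  ultimately have "dt v t x = c t x * c t x * dx u t x - a t x * v t x"
    using momentum[OF t, of x] by simp
  moreover have "\<sigma> * c t x * riemann_x \<sigma> t x
      = \<sigma> * c t x * dx v t x - (\<sigma> * \<sigma>) * (c t x * c t x * dx u t x)"
    by (simp add: riemann_x_def algebra_simps)
  ultimately show ?thesis
    by (simp add: \<sigma> mass[OF t])
qed

lemma continuous_riemann:
  "continuous_on ({0..T} \<times> UNIV) (\<lambda>(t, x). riemann \<sigma> t x)"
  "continuous_on ({0..T} \<times> UNIV) (\<lambda>(t, x). riemann_x \<sigma> t x)"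
proof -
  have "continuous_on ({0..T} \<times> UNIV)
      (\<lambda>p. v (fst p) (snd p) + \<sigma> * (2 / (\<gamma> - 1) * u (fst p) (snd p) powr (- (\<gamma> - 1) / 2)))"
    by (intro continuous_on_add continuous_on_mult continuous_on_const continuous_u_powr continuous_v)
  then show "continuous_on ({0..T} \<times> UNIV) (\<lambda>(t, x). riemann \<sigma> t x)"
    by (rule continuous_on_eq) (auto simp: riemann_def eta_eq gamma u_pos)
  show "continuous_on ({0..T} \<times> UNIV) (\<lambda>(t, x). riemann_x \<sigma> t x)"
    unfolding riemann_x_def case_prod_beta
    by (intro continuous_intros continuous_c continuous_u continuous_v)
qed

lemma c_bound:
  assumes "t \<in> {0..T}"
  shows "0 < c t x" "c t x \<le> d powr (- (\<gamma> + 1) / 2) + B powr (- (\<gamma> + 1) / 2)"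
  using assms d u_lower u_upper u_pos[OF assms, of x]
  unfolding c_def by (auto intro: powr_le_endpoints)

text \<open>The maximum principle on the unbounded line requires some finite bound beforehand; this
  one depends on the solution.\<close>

lemma riemann_bound:
  assumes t: "t \<in> {0..T}" and \<sigma>: "\<bar>\<sigma>\<bar> \<le> 1"
  shows "\<bar>riemann \<sigma> t x\<bar> \<le> B + 2 / (\<gamma> - 1) * (d powr (- (\<gamma> - 1) / 2) + B powr (- (\<gamma> - 1) / 2))"
proof -
  have "\<bar>riemann \<sigma> t x\<bar> \<le> \<bar>v t x\<bar> + \<bar>\<sigma>\<bar> * \<bar>eta \<gamma> (u t x)\<bar>"
    unfolding riemann_def using abs_triangle_ineq abs_mult by metis
  also have "\<dots> \<le> \<bar>v t x\<bar> + 1 * \<bar>eta \<gamma> (u t x)\<bar>"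
    by (intro add_mono mult_right_mono \<sigma>) auto
  also have "\<bar>eta \<gamma> (u t x)\<bar> = 2 / (\<gamma> - 1) * u t x powr (- (\<gamma> - 1) / 2)"
    using gamma by (simp add: eta_eq[OF gamma u_pos[OF t]])
  also have "\<bar>v t x\<bar> + 1 * (2 / (\<gamma> - 1) * u t x powr (- (\<gamma> - 1) / 2))
      \<le> B + 2 / (\<gamma> - 1) * (d powr (- (\<gamma> - 1) / 2) + B powr (- (\<gamma> - 1) / 2))"
    unfolding mult_1
    using gamma by (intro add_mono mult_left_mono v_bound powr_le_endpoints t d u_lower u_upper) auto
  finally show ?thesis .
qed

text \<open>With \<open>f = k * s\<close> and \<open>g = - k * r\<close>, the identity
  \<open>v = (s + r) / 2\<close> turns the damping into the coupling \<open>a / 2 * (g - f)\<close>.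
  The sign \<open>k = 1\<close> bounds \<open>s\<close> and \<open>- r\<close> from above, and
  \<open>k = - 1\<close> bounds them from below.\<close>

lemma riemann_upper_bound:
  assumes k: "\<bar>k\<bar> = 1" and init: "\<And>x. max (k * riemann 1 0 x) (- k * riemann (- 1) 0 x) \<le> M"
    and t: "t \<in> {0..T}"
  shows "max (k * riemann 1 t x) (- k * riemann (- 1) t x) \<le> M"
proof (rule coupled_transport_upper_bound[where T = T
      and f = "\<lambda>t x. k * riemann 1 t x" and g = "\<lambda>t x. - k * riemann (- 1) t x"
      and c\<^sub>1 = c and c\<^sub>2 = "\<lambda>t x. - c t x" and b = "\<lambda>t x. a t x / 2"])
  fix s y assume s: "s \<in> {0..T}"
  show "((\<lambda>\<tau>. k * riemann 1 \<tau> y) has_real_derivative k * (dt v s y - 1 * c s y * dt u s y))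
      (at s within {0..T})"
    by (rule DERIV_cmult riemann_derivatives s)+
  show "((\<lambda>\<tau>. - k * riemann (- 1) \<tau> y) has_real_derivative
      - k * (dt v s y - (- 1) * c s y * dt u s y)) (at s within {0..T})"
    by (rule DERIV_cmult riemann_derivatives s)+
  show "((\<lambda>y. k * riemann 1 s y) has_real_derivative k * riemann_x 1 s y) (at y)"
    by (rule DERIV_cmult riemann_derivatives s)+
  show "((\<lambda>y. - k * riemann (- 1) s y) has_real_derivative - k * riemann_x (- 1) s y) (at y)"
    by (rule DERIV_cmult riemann_derivatives s)+
  have v: "v s y = (riemann 1 s y + riemann (- 1) s y) / 2" by (simp add: riemann_def)
  have "k * (dt v s y - 1 * c s y * dt u s y + 1 * c s y * riemann_x 1 s y) = k * (- a s y * v s y)"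
    by (subst riemann_equation[OF s]) auto
  then show "k * (dt v s y - 1 * c s y * dt u s y) + c s y * (k * riemann_x 1 s y)
      = a s y / 2 * (- k * riemann (- 1) s y - k * riemann 1 s y)"
    unfolding v by (simp add: algebra_simps)
  have "k * (dt v s y - (- 1) * c s y * dt u s y + (- 1) * c s y * riemann_x (- 1) s y)
      = k * (- a s y * v s y)"
    by (subst riemann_equation[OF s]) auto
  then show "- k * (dt v s y - (- 1) * c s y * dt u s y) + - c s y * (- k * riemann_x (- 1) s y)
      = a s y / 2 * (k * riemann 1 s y - - k * riemann (- 1) s y)"
    unfolding v by (simp add: algebra_simps)
  show "0 \<le> a s y / 2" using a_nonneg[OF s] by simp
  show "\<bar>c s y\<bar> \<le> d powr (- (\<gamma> + 1) / 2) + B powr (- (\<gamma> + 1) / 2)"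
    using c_bound[OF s] by (simp add: less_imp_le)
  then show "\<bar>- c s y\<bar> \<le> d powr (- (\<gamma> + 1) / 2) + B powr (- (\<gamma> + 1) / 2)" by simp
  have "\<bar>k * riemann 1 s y\<bar> = \<bar>riemann 1 s y\<bar>"
    "\<bar>- k * riemann (- 1) s y\<bar> = \<bar>riemann (- 1) s y\<bar>"
    using k by (simp_all add: abs_mult)
  then show "max (k * riemann 1 s y) (- k * riemann (- 1) s y)
      \<le> B + 2 / (\<gamma> - 1) * (d powr (- (\<gamma> - 1) / 2) + B powr (- (\<gamma> - 1) / 2))"
    using riemann_bound[OF s, of 1 y] riemann_bound[OF s, of "- 1" y] by linarith
next
  show "continuous_on ({0..T} \<times> UNIV) (\<lambda>(t, x). k * riemann 1 t x)"
    "continuous_on ({0..T} \<times> UNIV) (\<lambda>(t, x). - k * riemann (- 1) t x)"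
    using continuous_riemann(1) unfolding case_prod_beta by (auto intro!: continuous_intros)
qed (use init t in auto)

end

section \<open>Characteristics and the Riccati equation along them\<close>

context damped_p_system begin

text \<open>The bounds on \<open>u\<close> and \<open>u\<^sub>x\<close> make the wave speed globally
  Lipschitz in space, so characteristics exist on all of [0, T].\<close>

lemma characteristic_exists:
  assumes \<sigma>: "\<bar>\<sigma>\<bar> = 1"
  obtains X where "X 0 = x\<^sub>0"
    and "\<And>t. t \<in> {0..T} \<Longrightarrow> (X has_real_derivative \<sigma> * c t (X t)) (at t within {0..T})"
proof -
  define q where "q = - (\<gamma> + 1) / 2 - 1"
  define L where "L = 1 + (\<gamma> + 1) / 2 * (d powr q + B powr q) * \<bar>B\<bar>"
  have c_x: "\<bar>c_x t x\<bar> \<le> L" if t: "t \<in> {0..T}" for t x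
  proof -
    have "\<bar>c_x t x\<bar> = (\<gamma> + 1) / 2 * u t x powr q * \<bar>dx u t x\<bar>"
      using gamma by (simp add: c_x_def q_def abs_mult)
    also have "\<dots> \<le> (\<gamma> + 1) / 2 * (d powr q + B powr q) * \<bar>B\<bar>"
      using gamma ux_bound[OF t, of x]
      by (intro mult_mono mult_left_mono powr_le_endpoints d u_lower u_upper t) auto
    finally show ?thesis by (simp add: L_def)
  qed
  show ?thesis
  proof (rule picard_lindelof[OF T, of L "\<lambda>t x. \<sigma> * c t x" x\<^sub>0])
    show "0 < L" using gamma by (simp add: L_def add_pos_nonneg)
    show "continuous_on ({0..T} \<times> UNIV) (\<lambda>(t, x). \<sigma> * c t x)"
      unfolding case_prod_beta by (intro continuous_intros continuous_c)
    fix t x y assume t: "t \<in> {0..T}"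
    have "norm (c t x - c t y) \<le> L * norm (x - y)"
      by (rule field_differentiable_bound[where S = UNIV and f' = "c_x t"])
        (use c_has_derivative[OF t] c_x[OF t] in auto)
    then show "\<bar>\<sigma> * c t x - \<sigma> * c t y\<bar> \<le> L * \<bar>x - y\<bar>"
      using \<sigma> by (simp add: abs_mult flip: right_diff_distrib)
  qed (rule that)
qed

text \<open>Along the characteristic, \<open>u' + \<sigma> c u\<^sub>x\<close> equals \<open>v\<^sub>x + \<sigma> c u\<^sub>x\<close>, the derivative of the other
  Riemann invariant. Hence the weight \<open>u powr -\<beta>\<close> removes the product of the two derivatives, and
  adding \<open>a G(u) / 2\<close> with \<open>G' = u powr -\<beta>\<close> absorbs the derivative that comes from the damping.\<close>

lemma riccati_equation:
  defines "\<beta> \<equiv> (\<gamma> + 1) / 4"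
  assumes \<sigma>: "\<sigma> * \<sigma> = 1"
    and G: "\<And>u. 0 < u \<Longrightarrow> (G has_real_derivative u powr (- \<beta>)) (at u)"
  obtains X y where "X 0 = x\<^sub>0" "y 0 = u 0 x\<^sub>0 powr (- \<beta>) * riemann_x \<sigma> 0 x\<^sub>0"
    and "\<And>t. t \<in> {0..T} \<Longrightarrow>
      ((\<lambda>t. y t + a t (X t) / 2 * G (u t (X t))) has_real_derivative
        - (\<beta> * u t (X t) powr (\<beta> - 1)) * (y t)\<^sup>2 - a t (X t) / 2 * y t
        + ((dt a t (X t) + \<sigma> * c t (X t) * dx a t (X t)) / 2 * G (u t (X t))
           - u t (X t) powr (- \<beta>) * dx a t (X t) * v t (X t))) (at t within {0..T})"
proof -
  have "\<bar>\<sigma>\<bar> = 1" using \<sigma> by (metis abs_1 abs_mult_self_eq abs_ge_zero power2_eq_1_iff power2_eq_square abs_minus_cancel)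
  then obtain X where X0: "X 0 = x\<^sub>0" and
    X: "\<And>t. t \<in> {0..T} \<Longrightarrow> (X has_real_derivative \<sigma> * c t (X t)) (at t within {0..T})"
    using characteristic_exists by blast
  define W where "W t = riemann_x \<sigma> t (X t)" for t
  define U where "U t = u t (X t)" for t
  define y where "y t = U t powr (- \<beta>) * W t" for t
  show ?thesis
  proof (rule that[of X y])
    show "X 0 = x\<^sub>0" by (rule X0)
    show "y 0 = u 0 x\<^sub>0 powr (- \<beta>) * riemann_x \<sigma> 0 x\<^sub>0" by (simp add: y_def U_def W_def X0)
    fix t assume t: "t \<in> {0..T}"
    have U_pos: "0 < U t" unfolding U_def by (rule u_pos[OF t])
    \<comment> \<open>The exponent \<open>\<beta>\<close> is half of that of the wave speed, so
      \<open>c\<close> is the square of this weight.\<close>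
    define E where "E = U t powr (- \<beta>)"
    have E: "0 < E" using U_pos by (simp add: E_def)
    have EE: "c t (X t) = E * E"
    proof -
      have "- (\<gamma> + 1) / 2 = - \<beta> + - \<beta>" by (simp add: \<beta>_def field_simps)
      then show ?thesis by (simp only: c_def E_def U_def powr_add)
    qed
    have c_x: "c_x t (X t) = - (2 * \<beta> * (E * E / U t) * dx u t (X t))"
    proof -
      have "u t (X t) powr (- (\<gamma> + 1) / 2 - 1) = E * E / U t"
        using U_pos unfolding EE[symmetric] c_def U_def by (simp add: powr_diff)
      moreover have "(\<gamma> + 1) / 2 = 2 * \<beta>" by (simp add: \<beta>_def)
      ultimately show ?thesis unfolding c_x_def by (simp only: mult.assoc)
    qed
    have powr_E: "U t powr (\<beta> - 1) = 1 / (E * U t)"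
      using U_pos by (simp add: E_def powr_diff powr_minus field_simps)
    have W': "(W has_real_derivative
        - (dx a t (X t) * v t (X t) + a t (X t) * dx v t (X t)) - \<sigma> * c_x t (X t) * W t)
        (at t within {0..T})"
      unfolding W_def
    proof (rule transport_space_derivative[where f = "riemann \<sigma>" and l = "\<lambda>t x. \<sigma> * c t x"
          and lx = "\<lambda>t x. \<sigma> * c_x t x" and g = "\<lambda>t x. - (a t x * v t x)"
          and gx = "\<lambda>t x. - (dx a t x * v t x + a t x * dx v t x)"])
      show "continuous_on ({0..T} \<times> UNIV) (\<lambda>(t, x). \<sigma> * c_x t x)"
        unfolding case_prod_beta c_x_def
        by (intro continuous_intros continuous_u continuous_u_powr)
      show "continuous_on ({0..T} \<times> UNIV) (\<lambda>(t, x). - (dx a t x * v t x + a t x * dx v t x))"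
        unfolding case_prod_beta
        by (intro continuous_intros continuous_a continuous_v)
      fix s x assume s: "s \<in> {0..T}"
      show "((\<lambda>x. - (a s x * v s x)) has_real_derivative
          - (dx a s x * v s x + a s x * dx v s x)) (at x)"
        using DERIV_minus[OF DERIV_mult[OF a_x[OF s, of x] v_x[OF s, of x]]]
        by (simp add: algebra_simps)
      show "((\<lambda>x. \<sigma> * c s x) has_real_derivative \<sigma> * c_x s x) (at x)"
        by (intro DERIV_cmult c_has_derivative s)
      show "dt v s x - \<sigma> * c s x * dt u s x + \<sigma> * c s x * riemann_x \<sigma> s x = - (a s x * v s x)"
        using riemann_equation[OF s \<sigma>] by simp
    qed (use riemann_derivatives continuous_riemann X t in blast)+
    have along: "((\<lambda>t. f t (X t)) has_real_derivative dt f t (X t) + dx f t (X t) * (\<sigma> * c t (X t)))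
        (at t within {0..T})" if "C1_on {0..T} f" for f
      by (rule has_real_derivative_along_curve[OF t C1_on_dt[OF that t time_subset] C1_on_dx[OF that]
            C1_on_continuous(2)[OF that] X[OF t]])
    define U' where "U' = dx v t (X t) + \<sigma> * c t (X t) * dx u t (X t)"
    have U': "(U has_real_derivative U') (at t within {0..T})"
      using along[OF C1_u] by (simp add: U_def[abs_def] U'_def mass[OF t] mult_ac)
    have W_eq: "W t = dx v t (X t) - \<sigma> * c t (X t) * dx u t (X t)"
      by (simp add: W_def riemann_x_def)
    have powr': "((\<lambda>t. U t powr (- \<beta>)) has_real_derivative - \<beta> * (E / U t) * U') (at t within {0..T})"
      using DERIV_chain2[OF has_real_derivative_powr[OF U_pos, of "- \<beta>"] U'] U_pos
      by (simp add: E_def powr_diff)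
    have G': "((\<lambda>t. G (U t)) has_real_derivative E * U') (at t within {0..T})"
      using DERIV_chain2[OF G[OF U_pos] U'] by (simp add: E_def)
    have "((\<lambda>t. y t + a t (X t) / 2 * G (U t)) has_real_derivative
        (- \<beta> * (E / U t) * U' * W t
         + (- (dx a t (X t) * v t (X t) + a t (X t) * dx v t (X t)) - \<sigma> * c_x t (X t) * W t) * E)
        + ((dt a t (X t) + dx a t (X t) * (\<sigma> * c t (X t))) / 2 * G (U t) + E * U' * (a t (X t) / 2)))
        (at t within {0..T})"
      unfolding y_def
      using DERIV_add[OF DERIV_mult[OF powr' W'] DERIV_mult[OF DERIV_cdivide[OF along[OF C1_a]] G']]
      by (simp add: E_def)
    also have "(- \<beta> * (E / U t) * U' * W t
         + (- (dx a t (X t) * v t (X t) + a t (X t) * dx v t (X t)) - \<sigma> * c_x t (X t) * W t) * E)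
        + ((dt a t (X t) + dx a t (X t) * (\<sigma> * c t (X t))) / 2 * G (U t) + E * U' * (a t (X t) / 2))
      = - (\<beta> * U t powr (\<beta> - 1)) * (y t)\<^sup>2 - a t (X t) / 2 * y t
        + ((dt a t (X t) + \<sigma> * c t (X t) * dx a t (X t)) / 2 * G (U t)
           - U t powr (- \<beta>) * dx a t (X t) * v t (X t))"
    proof -
      \<comment> \<open>Everything is expressed through \<open>W\<close> and \<open>U'\<close>, the
        spatial derivatives of the two invariants. The product \<open>U' * W\<close> from the weight
        cancels against the one from \<open>c_x\<close>, and \<open>a / 2 * E * U'\<close> from
        \<open>v\<^sub>x\<close> cancels against the derivative of \<open>G\<close>.\<close>
      have y: "y t = E * W t" by (simp add: y_def E_def)
      have vx: "dx v t (X t) = (W t + U') / 2" by (simp add: W_eq U'_def)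
      have ux: "\<sigma> * (E * E) * dx u t (X t) = (U' - W t) / 2" by (simp add: W_eq U'_def EE)
      have cx: "\<sigma> * c_x t (X t) = - (\<beta> * (U' - W t) / U t)"
      proof -
        have "\<sigma> * c_x t (X t) = - (2 * \<beta> * (\<sigma> * (E * E) * dx u t (X t)) / U t)"
          by (simp add: c_x)
        then show ?thesis unfolding ux by simp
      qed
      have quad: "\<beta> * U t powr (\<beta> - 1) * (y t)\<^sup>2 = \<beta> * E / U t * (W t)\<^sup>2"
        using E U_pos by (simp add: powr_E y power2_eq_square)
      show ?thesis
        unfolding mult_minus_left quad
        unfolding cx vx y E_def[symmetric]
        by (simp add: algebra_simps power2_eq_square add_divide_distrib diff_divide_distrib)
    qed
    finally show "((\<lambda>t. y t + a t (X t) / 2 * G (u t (X t))) has_real_derivative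
        - (\<beta> * u t (X t) powr (\<beta> - 1)) * (y t)\<^sup>2 - a t (X t) / 2 * y t
        + ((dt a t (X t) + \<sigma> * c t (X t) * dx a t (X t)) / 2 * G (u t (X t))
           - u t (X t) powr (- \<beta>) * dx a t (X t) * v t (X t))) (at t within {0..T})"
      by (simp add: U_def)
  qed
qed

end

subsection \<open>Blow-up of steep gradients\<close>

text \<open>The logarithmic case does occur: with \<open>q = - \<beta>\<close> it is \<gamma> =
  3.\<close>

lemma powr_antiderivative:
  obtains G :: "real \<Rightarrow> real" where "\<And>u. 0 < u \<Longrightarrow> (G has_real_derivative u powr q) (at u)"
proof (cases "q = - 1")
  case True
  show ?thesis
    by (rule that[of ln]) (auto intro!: derivative_eq_intros simp: True powr_minus divide_inverse)
next
  case False
  then have "q + 1 \<noteq> 0" by simp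
  then have "((\<lambda>u. u powr (q + 1) / (q + 1)) has_real_derivative u powr q) (at u)" if "0 < u" for u
    using DERIV_cdivide[OF has_real_derivative_powr[OF that, of "q + 1"], of "q + 1"] by simp
  then show ?thesis by (rule that)
qed

text \<open>Along a characteristic the shifted and weighted slope satisfies a Riccati inequality on
  [0, 1] whose constants come from the uniform bounds. Hence \<open>K\<close> is fixed before the
  solution and before its own constants \<open>d\<close> and \<open>B\<close>.\<close>

lemma gradient_blowup:
  fixes \<gamma> \<delta> m V A A' :: real
  assumes \<gamma>: "1 < \<gamma>" and \<delta>: "0 < \<delta>" and V: "0 \<le> V" and A': "0 \<le> A'"
  obtains K where "\<And>d B a u v \<sigma> x\<^sub>0. damped_p_system \<gamma> 1 d B a u v \<Longrightarrow>
    (\<And>t x. t \<in> {0..1} \<Longrightarrow> \<delta> \<le> u t x \<and> u t x \<le> m \<and> \<bar>v t x\<bar> \<le> V \<and>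
       a t x \<le> A \<and> \<bar>dt a t x\<bar> + \<bar>dx a t x\<bar> \<le> A') \<Longrightarrow>
    \<bar>\<sigma>\<bar> = 1 \<Longrightarrow> damped_p_system.riemann_x \<gamma> u v \<sigma> 0 x\<^sub>0 \<le> - K \<Longrightarrow> False"
proof -
  define \<beta> where "\<beta> = (\<gamma> + 1) / 4"
  have \<beta>: "0 < \<beta>" using \<gamma> by (simp add: \<beta>_def)
  define P where "P q = \<delta> powr q + m powr q" for q
  have P: "u powr q \<le> P q" if "\<delta> \<le> u" "u \<le> m" for u q
    unfolding P_def using \<delta> that by (rule powr_le_endpoints)
  have P_pos: "0 < P q" for q using \<delta> by (simp add: P_def add_pos_nonneg)
  then have P_nonneg: "0 \<le> P q" for q by (rule less_imp_le)
  obtain G :: "real \<Rightarrow> real" where G: "\<And>u. 0 < u \<Longrightarrow> (G has_real_derivative u powr (- \<beta>)) (at u)"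
    using powr_antiderivative[of "- \<beta>"] by blast
  have "continuous_on {\<delta>..m} G"
    by (rule DERIV_continuous_on[OF has_field_derivative_at_within[OF G]]) (use \<delta> in auto)
  then have "bounded (G ` {\<delta>..m})"
    by (intro compact_imp_bounded compact_continuous_image) auto
  then obtain G\<^sub>0 where "0 < G\<^sub>0" and G\<^sub>0: "\<And>u. \<delta> \<le> u \<Longrightarrow> u \<le> m \<Longrightarrow> \<bar>G u\<bar> \<le> G\<^sub>0"
    by (force simp: bounded_pos)
  \<comment> \<open>A lower bound for the quadratic coefficient, written as
    \<open>\<beta> / u powr (1 - \<beta>)\<close> so that an upper bound for a power of
    \<open>u\<close> suffices.\<close>
  define k where "k = \<beta> / P (1 - \<beta>)"
  have k: "0 < k" using \<beta> P_pos by (simp add: k_def)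
  define E where "E = A / 2 * G\<^sub>0"
  define Q where "Q = (1 + P (- (\<gamma> + 1) / 2)) * A' / 2 * G\<^sub>0 + P (- \<beta>) * A' * V"
  \<comment> \<open>Beyond this level the quadratic term dominates; the summand \<open>8 / k\<close>
    ensures \<open>1 \<le> k / 8 * N\<close>, that is, blow-up within unit time.\<close>
  define N where "N = 1 + 2 * E + 24 * (A / 2) / k + 16 * Q / k + 8 / k"
  \<comment> \<open>Dividing by \<open>P \<beta>\<close> accounts for the weight and
    \<open>E\<close> for the shift, so a slope of at most \<open>- K\<close> starts \<open>z\<close>
    strictly below \<open>- N\<close>.\<close>
  define K where "K = P \<beta> * (N + E + 1)"
  show ?thesis
  proof (rule that[of K])
    fix d B a u v \<sigma> x\<^sub>0
    assume sys: "damped_p_system \<gamma> 1 d B a u v"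
      and bounds: "\<And>t x. t \<in> {0..1} \<Longrightarrow> \<delta> \<le> u t x \<and> u t x \<le> m \<and> \<bar>v t x\<bar> \<le> V \<and>
        a t x \<le> A \<and> \<bar>dt a t x\<bar> + \<bar>dx a t x\<bar> \<le> A'"
      and \<sigma>: "\<bar>\<sigma>\<bar> = 1" and steep: "damped_p_system.riemann_x \<gamma> u v \<sigma> 0 x\<^sub>0 \<le> - K"
    interpret damped_p_system \<gamma> 1 d B a u v by (rule sys)
    have "\<sigma> * \<sigma> = 1" using \<sigma> by (metis abs_mult_self_eq mult_1)
    from riccati_equation[OF this G[unfolded \<beta>_def], of x\<^sub>0, folded \<beta>_def]
    obtain X y where X0: "X 0 = x\<^sub>0" and y0: "y 0 = u 0 x\<^sub>0 powr (- \<beta>) * riemann_x \<sigma> 0 x\<^sub>0"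
      and der: "\<And>t. t \<in> {0..1} \<Longrightarrow>
        ((\<lambda>t. y t + a t (X t) / 2 * G (u t (X t))) has_real_derivative
          - (\<beta> * u t (X t) powr (\<beta> - 1)) * (y t)\<^sup>2 - a t (X t) / 2 * y t
          + ((dt a t (X t) + \<sigma> * c t (X t) * dx a t (X t)) / 2 * G (u t (X t))
             - u t (X t) powr (- \<beta>) * dx a t (X t) * v t (X t))) (at t within {0..1})"
      by blast
    define z where "z t = y t + a t (X t) / 2 * G (u t (X t))" for t
    define z' where "z' t = - (\<beta> * u t (X t) powr (\<beta> - 1)) * (y t)\<^sup>2 - a t (X t) / 2 * y t
          + ((dt a t (X t) + \<sigma> * c t (X t) * dx a t (X t)) / 2 * G (u t (X t))
             - u t (X t) powr (- \<beta>) * dx a t (X t) * v t (X t))" for t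
    have e: "\<bar>a t (X t) / 2 * G (u t (X t))\<bar> \<le> E" if t: "t \<in> {0..1}" for t
    proof -
      have "\<bar>a t (X t) / 2\<bar> * \<bar>G (u t (X t))\<bar> \<le> A / 2 * G\<^sub>0"
        using bounds[OF t, of "X t"] a_nonneg[OF t, of "X t"] G\<^sub>0[of "u t (X t)"]
        by (intro mult_mono) auto
      then show ?thesis by (simp add: E_def abs_mult)
    qed
    have A: "0 \<le> A" using bounds[of 0 0] a_nonneg[of 0 0] by auto
    have E: "0 \<le> E" using A \<open>0 < G\<^sub>0\<close> by (simp add: E_def)
    have "0 \<le> Q" using A' V P_nonneg \<open>0 < G\<^sub>0\<close> by (simp add: Q_def)
    then have N: "1 \<le> N" "8 / k \<le> N"
      "1 + 2 * E + 24 * (A / 2) / k + 16 * Q / k \<le> N"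
      using E A k by (auto simp: N_def)
    have growth: "z' t \<le> - (k / 8) * (z t)\<^sup>2" if t: "t \<in> {0..1}" and "z t < - N" for t
      unfolding z'_def
    proof (rule quadratic_dominates[OF k _ z_def e[OF t]])
      have u: "\<delta> \<le> u t (X t)" "u t (X t) \<le> m" "0 < u t (X t)"
        using bounds[OF t, of "X t"] u_pos[OF t, of "X t"] by auto
      have "\<beta> * u t (X t) powr (\<beta> - 1) = \<beta> / u t (X t) powr (1 - \<beta>)"
        using powr_minus_divide[of "u t (X t)" "1 - \<beta>"] by simp
      then show "k \<le> \<beta> * u t (X t) powr (\<beta> - 1)"
        using P[OF u(1,2), of "1 - \<beta>"] \<beta> u unfolding k_def by (auto intro!: divide_left_mono mult_pos_pos P_pos)
      show "0 \<le> a t (X t) / 2" "a t (X t) / 2 \<le> A / 2"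
        using bounds[OF t, of "X t"] a_nonneg[OF t, of "X t"] by auto
      have "\<bar>\<sigma> * c t (X t) * dx a t (X t)\<bar> = c t (X t) * \<bar>dx a t (X t)\<bar>"
        using \<sigma> c_bound(1)[OF t, of "X t"] by (simp add: abs_mult)
      then have "\<bar>dt a t (X t) + \<sigma> * c t (X t) * dx a t (X t)\<bar>
          \<le> \<bar>dt a t (X t)\<bar> + c t (X t) * \<bar>dx a t (X t)\<bar>"
        using abs_triangle_ineq[of "dt a t (X t)"] by metis
      also have "\<dots> \<le> A' + P (- (\<gamma> + 1) / 2) * A'"
        using bounds[OF t, of "X t"] P[OF u(1,2)] A' unfolding c_def
        by (intro add_mono mult_mono P_nonneg) auto
      finally have "\<bar>(dt a t (X t) + \<sigma> * c t (X t) * dx a t (X t)) / 2\<bar>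
          \<le> (1 + P (- (\<gamma> + 1) / 2)) * A' / 2"
        by (simp add: algebra_simps)
      then have "\<bar>(dt a t (X t) + \<sigma> * c t (X t) * dx a t (X t)) / 2\<bar> * \<bar>G (u t (X t))\<bar>
          \<le> (1 + P (- (\<gamma> + 1) / 2)) * A' / 2 * G\<^sub>0"
        using G\<^sub>0[OF u(1,2)] by (rule mult_mono) (use A' P_nonneg in auto)
      moreover have "\<bar>u t (X t) powr (- \<beta>)\<bar> * \<bar>dx a t (X t)\<bar> * \<bar>v t (X t)\<bar> \<le> P (- \<beta>) * A' * V"
        using bounds[OF t, of "X t"] P[OF u(1,2)] A'
        by (intro mult_mono mult_nonneg_nonneg P_nonneg) auto
      ultimately show "\<bar>(dt a t (X t) + \<sigma> * c t (X t) * dx a t (X t)) / 2 * G (u t (X t))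
          - u t (X t) powr (- \<beta>) * dx a t (X t) * v t (X t)\<bar> \<le> Q"
        unfolding Q_def abs_mult[symmetric] by linarith
      show "z t < - (1 + 2 * E + 24 * (A / 2) / k + 16 * Q / k)"
        using N \<open>z t < - N\<close> by linarith
    qed
    have K: "0 \<le> K" using N E P_pos[of \<beta>] by (simp add: K_def)
    have "z 0 < - N"
    proof -
      have u: "\<delta> \<le> u 0 x\<^sub>0" "u 0 x\<^sub>0 \<le> m" "0 < u 0 x\<^sub>0"
        using bounds[of 0 x\<^sub>0] u_pos[of 0 x\<^sub>0] by auto
      have "y 0 \<le> u 0 x\<^sub>0 powr (- \<beta>) * (- K)"
        unfolding y0 by (intro mult_left_mono steep) auto
      also have "\<dots> = - (K / u 0 x\<^sub>0 powr \<beta>)" by (simp add: powr_minus divide_inverse)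
      also have "\<dots> \<le> - (K / P \<beta>)"
        using P[OF u(1,2), of \<beta>] u K by (auto intro!: divide_left_mono mult_pos_pos P_pos)
      also have "\<dots> = - (N + E + 1)" using P_pos[of \<beta>] by (simp add: K_def)
      finally show ?thesis using e[of 0] by (auto simp: z_def)
    qed
    show False
    proof (rule riccati_blowup[of 1 z z' N "k / 8"])
      show "1 \<le> k / 8 * N * 1" using N k by (simp add: field_simps)
    qed (use N k growth \<open>z 0 < - N\<close> der in \<open>auto simp: z_def[abs_def] z'_def[abs_def]\<close>)
  qed
qed

section \<open>The invariant square for the Riemann invariants\<close>

context damped_p_system begin

text \<open>The maximum principle with both signs keeps \<open>s\<close> and \<open>- r\<close> in
  [\<open>L\<close>, \<open>M\<close>]. Their mean is \<open>\<eta>(u)\<close>, and half of their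
  difference is \<open>v\<close>.\<close>

lemma riemann_invariant_square:
  assumes init: "\<And>x. L \<le> riemann 1 0 x \<and> riemann 1 0 x \<le> M"
      "\<And>x. L \<le> - riemann (- 1) 0 x \<and> - riemann (- 1) 0 x \<le> M"
    and t: "t \<in> {0..T}" and L: "0 \<le> L"
  shows "L \<le> eta \<gamma> (u t x)" "eta \<gamma> (u t x) \<le> M" "\<bar>v t x\<bar> \<le> M"
proof -
  have "max (1 * riemann 1 t x) (- 1 * riemann (- 1) t x) \<le> M"
    by (rule riemann_upper_bound) (use init t in auto)
  moreover have "max (- 1 * riemann 1 t x) (- (- 1) * riemann (- 1) t x) \<le> - L"
  proof (rule riemann_upper_bound)
    show "max (- 1 * riemann 1 0 y) (- (- 1) * riemann (- 1) 0 y) \<le> - L" for y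
      using init(1)[of y] init(2)[of y] by linarith
  qed (use t in auto)
  ultimately show "L \<le> eta \<gamma> (u t x)" "eta \<gamma> (u t x) \<le> M" "\<bar>v t x\<bar> \<le> M"
    using L by (auto simp: riemann_def)
qed

end

subsection \<open>Regular solutions\<close>

lemma norm_le_sup_norm: "ereal (norm (f x)) \<le> sup_norm f"
  unfolding sup_norm_def by (rule SUP_upper) simp

lemma sup_norm_leI: "(\<And>x. norm (f x) \<le> b) \<Longrightarrow> sup_norm f \<le> ereal b"
  unfolding sup_norm_def by (rule SUP_least) simp

lemma sup_norm_nonneg: "0 \<le> sup_norm f"
  by (rule order_trans[OF _ norm_le_sup_norm[of f undefined]]) simp

lemma X_spaceD:
  assumes "(u, v) \<in> X_space m \<delta>"
  shows "\<delta> \<le> u x" "u x \<le> m" "\<bar>v x\<bar> \<le> m"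
proof -
  have sum: "sup_norm u + sup_norm v \<le> ereal m" and lower: "\<delta> \<le> u x"
    using assms by (auto simp: X_space_def)
  show "\<delta> \<le> u x" by (rule lower)
  have "ereal (norm (u x)) \<le> ereal m" "ereal (norm (v x)) \<le> ereal m"
    using sum sup_norm_nonneg[of u] sup_norm_nonneg[of v] norm_le_sup_norm[of u x] norm_le_sup_norm[of v x]
    by (meson order_trans add_increasing add_increasing2)+
  then show "u x \<le> m" "\<bar>v x\<bar> \<le> m" by auto
qed

text \<open>All four norms are nonnegative, so a finite supremum of their sum bounds each one. The
  last is the supremum of \<open>u powr (- (\<gamma> + 1))\<close>, which keeps \<open>u\<close>
  away from 0.\<close>

lemma regular_solution_bounds:
  assumes \<gamma>: "1 < \<gamma>" and reg: "regular_solution \<gamma> a u\<^sub>0 v\<^sub>0 T u v"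
  obtains B where "0 < B"
    and "\<And>t x. t \<in> {0..<T} \<Longrightarrow> \<bar>u t x\<bar> \<le> B \<and> \<bar>v t x\<bar> \<le> B \<and> \<bar>dx u t x\<bar> \<le> B \<and>
      \<bar>dx v t x\<bar> \<le> B \<and> u t x powr (- (\<gamma> + 1)) \<le> B"
proof -
  define n where "n t = sup_norm (\<lambda>x. (u t x, v t x)) + sup_norm (\<lambda>x. (dt u t x, dt v t x)) +
        sup_norm (\<lambda>x. (dx u t x, dx v t x)) + sup_norm (\<lambda>x. deriv (pressure \<gamma>) (u t x))" for t
  have "(SUP t\<in>{0..<T}. n t) < \<infinity>"
    using reg unfolding regular_solution_def n_def by blast
  then obtain N where N: "(SUP t\<in>{0..<T}. n t) < ereal (real N)"
    using less_PInf_Ex_of_nat by auto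
  show ?thesis
  proof (rule that[of "real N + 1"])
    show "0 < real N + 1" by simp
    fix t x assume t: "t \<in> {0..<T}"
    have "n t \<le> ereal (real N)"
      using N SUP_upper[OF t, of n] by (meson less_imp_le order_trans)
    then have "sup_norm (\<lambda>x. (u t x, v t x)) \<le> ereal (real N)"
      "sup_norm (\<lambda>x. (dx u t x, dx v t x)) \<le> ereal (real N)"
      "sup_norm (\<lambda>x. deriv (pressure \<gamma>) (u t x)) \<le> ereal (real N)"
      unfolding n_def
      by (smt (verit) sup_norm_nonneg add_increasing add_increasing2 add_nonneg_nonneg order_refl order_trans)+
    then have le: "norm (u t x, v t x) \<le> real N" "norm (dx u t x, dx v t x) \<le> real N"
      "norm (deriv (pressure \<gamma>) (u t x)) \<le> real N"
      using norm_le_sup_norm order_trans by (metis (no_types, lifting) ereal_less_eq(3))+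
    have "0 < u t x" using reg t by (auto simp: regular_solution_def C1_solution_def)
    then have "u t x powr (- (\<gamma> + 1)) \<le> real N"
      using le(3) by (simp add: deriv_pressure[OF \<gamma>])
    then show "\<bar>u t x\<bar> \<le> real N + 1 \<and> \<bar>v t x\<bar> \<le> real N + 1 \<and> \<bar>dx u t x\<bar> \<le> real N + 1 \<and>
      \<bar>dx v t x\<bar> \<le> real N + 1 \<and> u t x powr (- (\<gamma> + 1)) \<le> real N + 1"
      using le(1,2) norm_fst_le[of "u t x" "v t x"] norm_snd_le[of "v t x" "u t x"]
        norm_fst_le[of "dx u t x" "dx v t x"] norm_snd_le[of "dx v t x" "dx u t x"] by auto
  qed
qed

text \<open>A solution on [0, T) is restricted to the closed interval [0, S]; inverting the bound on
  \<open>p'(u)\<close> supplies the positive lower bound for \<open>u\<close>.\<close>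

lemma regular_solution_damped_p_system:
  assumes \<gamma>: "1 < \<gamma>" and reg: "regular_solution \<gamma> a u\<^sub>0 v\<^sub>0 T u v" and S: "0 \<le> S" "S < T"
    and a: "C1_on {0..} a" "\<And>t x. 0 \<le> t \<Longrightarrow> 0 \<le> a t x"
  obtains d B where "damped_p_system \<gamma> S d B a u v"
proof -
  obtain B where B: "0 < B" and bounds: "\<And>t x. t \<in> {0..<T} \<Longrightarrow> \<bar>u t x\<bar> \<le> B \<and> \<bar>v t x\<bar> \<le> B \<and>
      \<bar>dx u t x\<bar> \<le> B \<and> \<bar>dx v t x\<bar> \<le> B \<and> u t x powr (- (\<gamma> + 1)) \<le> B"
    using regular_solution_bounds[OF \<gamma> reg] by blast
  have sol: "C1_solution \<gamma> a u\<^sub>0 v\<^sub>0 T u v" using reg by (simp add: regular_solution_def)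
  have sub: "{0..S} \<subseteq> {0..<T}" using S by auto
  show ?thesis
  proof (rule that[of "B powr (- 1 / (\<gamma> + 1))" B], unfold_locales)
    show "C1_on {0..S} a" using a(1) by (rule C1_on_subset) auto
    show "C1_on {0..S} u" "C1_on {0..S} v"
      using sol sub by (auto simp: C1_solution_def intro: C1_on_subset)
    fix t x assume "t \<in> {0..S}"
    then have t: "t \<in> {0..<T}" using sub by blast
    have pde: "u t x > 0" "dt u t x - dx v t x = 0"
      "dt v t x + dx (\<lambda>t x. pressure \<gamma> (u t x)) t x = - a t x * v t x"
      using sol t unfolding C1_solution_def by blast+
    show "dt u t x = dx v t x" using pde by simp
    show "dt v t x + dx (\<lambda>t x. pressure \<gamma> (u t x)) t x = - a t x * v t x" by (rule pde)
    show "B powr (- 1 / (\<gamma> + 1)) \<le> u t x"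
      using powr_uminus_le_iff(1)[OF pde(1) B, of "\<gamma> + 1"] bounds[OF t, of x] \<gamma> by auto
    show "u t x \<le> B" "\<bar>v t x\<bar> \<le> B" "\<bar>dx u t x\<bar> \<le> B" using bounds[OF t, of x] by auto
    show "0 \<le> a t x" using a(2) t by auto
  qed (use \<gamma> S B in auto)
qed

text \<open>With \<open>e = (\<gamma> - 1) / 2\<close> one has
  \<open>\<eta>(u) = u powr (- e) / e\<close>, a decreasing function; these are its inverse values
  at \<open>M\<close> and \<open>L\<close>.\<close>

lemma eta_sublevel_bounds:
  assumes \<gamma>: "1 < \<gamma>" and u: "0 < u" and L: "0 < L" "L \<le> eta \<gamma> u" and M: "eta \<gamma> u \<le> M"
  shows "((\<gamma> - 1) / 2 * M) powr (- 1 / ((\<gamma> - 1) / 2)) \<le> u"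
    and "u \<le> ((\<gamma> - 1) / 2 * L) powr (- 1 / ((\<gamma> - 1) / 2))"
proof -
  define e where "e = (\<gamma> - 1) / 2"
  have e: "0 < e" using \<gamma> by (simp add: e_def)
  have "eta \<gamma> u = 1 / e * u powr (- e)"
    using eta_eq[OF \<gamma> u] by (simp add: e_def minus_divide_left)
  then have eq: "u powr (- e) = e * eta \<gamma> u" using e by simp
  have "e * L \<le> u powr (- e)" "u powr (- e) \<le> e * M"
    unfolding eq using e L M by auto
  moreover have "0 < e * L" "0 < e * M" using e L M by auto
  ultimately show "((\<gamma> - 1) / 2 * M) powr (- 1 / ((\<gamma> - 1) / 2)) \<le> u"
    "u \<le> ((\<gamma> - 1) / 2 * L) powr (- 1 / ((\<gamma> - 1) / 2))"
    using powr_uminus_le_iff[OF u _ e] unfolding e_def[symmetric] by blast+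
qed

lemma eta_antimono:
  assumes "1 < \<gamma>" "0 < u" "u \<le> w"
  shows "eta \<gamma> w \<le> eta \<gamma> u"
proof -
  have "w powr (- (\<gamma> - 1) / 2) \<le> u powr (- (\<gamma> - 1) / 2)"
    using assms by (intro powr_mono2') auto
  then show ?thesis using assms by (simp add: eta_eq divide_right_mono)
qed

lemma eta_pos: "1 < \<gamma> \<Longrightarrow> 0 < u \<Longrightarrow> 0 < eta \<gamma> u"
  by (simp add: eta_eq)

text \<open>The predicate \<open>D\<close> stands for a class of dampings with uniform bounds, so
  that both kinds of decay are instances. The derivative bound \<open>A'\<close> is quantified after
  the first three constants, so it influences \<open>K\<close> alone.\<close>

lemma bounded_damping_blowup:
  fixes \<gamma> m \<delta> A :: real
  assumes \<gamma>: "1 < \<gamma>" and m: "0 < m" and \<delta>: "0 < \<delta>"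
    and D_C1: "\<And>A' a. 0 < A' \<Longrightarrow> D A' a \<Longrightarrow> C1_on {0..} a"
    and D_bounds: "\<And>A' a. 0 < A' \<Longrightarrow> D A' a \<Longrightarrow>
      \<forall>t\<ge>0. \<forall>x. 0 \<le> a t x \<and> a t x \<le> A \<and> \<bar>dt a t x\<bar> + \<bar>dx a t x\<bar> \<le> A'"
  shows "\<exists>\<epsilon>>0. \<exists>m\<^sub>1>0. \<exists>\<delta>\<^sub>1>0. \<forall>A'>0. \<exists>K::real.
    \<forall>u\<^sub>0 v\<^sub>0 a u v. \<forall>u\<^sub>m>0. \<forall>v\<^sub>m.
      (u\<^sub>0, v\<^sub>0) \<in> X_space m \<delta> \<and>
      D A' a \<and>
      ((\<lambda>x. (u\<^sub>0 x, v\<^sub>0 x)) \<longlongrightarrow> (u\<^sub>m, v\<^sub>m)) at_bot \<and>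
      solution_on_lifespan \<gamma> a u\<^sub>0 v\<^sub>0 u v \<and>
      sup_norm (\<lambda>(x, y). riemann_s \<gamma> (u\<^sub>0 x) (v\<^sub>0 x) + riemann_r \<gamma> (u\<^sub>0 y) (v\<^sub>0 y)) < ereal \<epsilon>
      \<longrightarrow>
      (\<forall>t\<ge>0. ereal t < lifespan \<gamma> a u\<^sub>0 v\<^sub>0 \<longrightarrow> (u t, v t) \<in> X_space m\<^sub>1 \<delta>\<^sub>1) \<and>
      ((\<exists>x\<^sub>0. deriv (\<lambda>x. riemann_r \<gamma> (u\<^sub>0 x) (v\<^sub>0 x)) x\<^sub>0 \<le> - K \<or>
             deriv (\<lambda>x. riemann_s \<gamma> (u\<^sub>0 x) (v\<^sub>0 x)) x\<^sub>0 \<le> - K)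
         \<longrightarrow> lifespan \<gamma> a u\<^sub>0 v\<^sub>0 < \<infinity>)"
proof -
  \<comment> \<open>With \<open>\<epsilon> = eta \<gamma> m\<close>, smallness on the diagonal gives
    \<open>|v\<^sub>0| < eta \<gamma> m / 2\<close>, while \<open>eta \<gamma> m \<le>
    \<eta>(u\<^sub>0) \<le> eta \<gamma> \<delta>\<close>. So \<open>s\<close> and
    \<open>- r\<close> start between \<open>L\<close> and \<open>M\<close>.\<close>
  define L where "L = eta \<gamma> m / 2"
  define M where "M = eta \<gamma> \<delta> + m"
  have L: "0 < L" using eta_pos[OF \<gamma> m] by (simp add: L_def)
  have M: "0 < M" using eta_pos[OF \<gamma> \<delta>] m by (simp add: M_def)
  define \<delta>\<^sub>1 where "\<delta>\<^sub>1 = ((\<gamma> - 1) / 2 * M) powr (- 1 / ((\<gamma> - 1) / 2))"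
  define m\<^sub>1 where "m\<^sub>1 = ((\<gamma> - 1) / 2 * L) powr (- 1 / ((\<gamma> - 1) / 2))"
  have \<delta>\<^sub>1: "0 < \<delta>\<^sub>1" and m\<^sub>1: "0 < m\<^sub>1" using \<gamma> L M by (auto simp: \<delta>\<^sub>1_def m\<^sub>1_def)
  define admissible where "admissible A' u\<^sub>0 v\<^sub>0 a u v \<longleftrightarrow> (u\<^sub>0, v\<^sub>0) \<in> X_space m \<delta> \<and> C1_on {0..} a \<and>
    (\<forall>t\<ge>0. \<forall>x. 0 \<le> a t x \<and> a t x \<le> A \<and> \<bar>dt a t x\<bar> + \<bar>dx a t x\<bar> \<le> A') \<and>
    solution_on_lifespan \<gamma> a u\<^sub>0 v\<^sub>0 u v \<and>
    sup_norm (\<lambda>(x, y). riemann_s \<gamma> (u\<^sub>0 x) (v\<^sub>0 x) + riemann_r \<gamma> (u\<^sub>0 y) (v\<^sub>0 y)) < ereal (eta \<gamma> m)"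
    for A' u\<^sub>0 v\<^sub>0 a u v
  \<comment> \<open>Here \<open>u\<close> and \<open>v\<close> are an arbitrary regular solution,
    distinct from the pair \<open>u'\<close>, \<open>v'\<close> in the hypotheses; the estimate thus
    applies to every solution that witnesses the lifespan.\<close>
  have bounds: "\<delta>\<^sub>1 \<le> u t x \<and> u t x \<le> m\<^sub>1 \<and> \<bar>v t x\<bar> \<le> M"
    if adm: "admissible A' u\<^sub>0 v\<^sub>0 a u' v'" and reg: "regular_solution \<gamma> a u\<^sub>0 v\<^sub>0 T u v"
      and t: "0 \<le> t" "t < T" for A' u\<^sub>0 v\<^sub>0 a u' v' T u v t x
  proof -
    have X: "(u\<^sub>0, v\<^sub>0) \<in> X_space m \<delta>" and
      small: "sup_norm (\<lambda>(x, y). riemann_s \<gamma> (u\<^sub>0 x) (v\<^sub>0 x) + riemann_r \<gamma> (u\<^sub>0 y) (v\<^sub>0 y)) < ereal (eta \<gamma> m)"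
      using adm by (auto simp: admissible_def)
    obtain d B where "damped_p_system \<gamma> t d B a u v"
      using regular_solution_damped_p_system[OF \<gamma> reg t] adm unfolding admissible_def by blast
    then interpret damped_p_system \<gamma> t d B a u v .
    have u0: "u 0 x = u\<^sub>0 x" "v 0 x = v\<^sub>0 x" for x
      using reg by (auto simp: regular_solution_def C1_solution_def)
    have init: "L \<le> v\<^sub>0 x + eta \<gamma> (u\<^sub>0 x)" "v\<^sub>0 x + eta \<gamma> (u\<^sub>0 x) \<le> M"
      "L \<le> eta \<gamma> (u\<^sub>0 x) - v\<^sub>0 x" "eta \<gamma> (u\<^sub>0 x) - v\<^sub>0 x \<le> M" for x
    proof -
      \<comment> \<open>On the diagonal \<open>y = x\<close> the sum of the invariants is
        \<open>2 * v\<^sub>0 x\<close>.\<close>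
      have "ereal (norm (case (x, x) of (x, y) \<Rightarrow> riemann_s \<gamma> (u\<^sub>0 x) (v\<^sub>0 x) + riemann_r \<gamma> (u\<^sub>0 y) (v\<^sub>0 y)))
          < ereal (eta \<gamma> m)"
        by (rule le_less_trans[OF norm_le_sup_norm small])
      then have "\<bar>v\<^sub>0 x\<bar> < eta \<gamma> m / 2" by (simp add: riemann_s_def riemann_r_def)
      moreover have "eta \<gamma> m \<le> eta \<gamma> (u\<^sub>0 x)" "eta \<gamma> (u\<^sub>0 x) \<le> eta \<gamma> \<delta>"
        using X_spaceD[OF X, of x] \<delta> by (auto intro!: eta_antimono[OF \<gamma>])
      ultimately show "L \<le> v\<^sub>0 x + eta \<gamma> (u\<^sub>0 x)" "v\<^sub>0 x + eta \<gamma> (u\<^sub>0 x) \<le> M"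
        "L \<le> eta \<gamma> (u\<^sub>0 x) - v\<^sub>0 x" "eta \<gamma> (u\<^sub>0 x) - v\<^sub>0 x \<le> M"
        using X_spaceD(3)[OF X, of x] by (auto simp: L_def M_def)
    qed
    have "L \<le> eta \<gamma> (u t x)" "eta \<gamma> (u t x) \<le> M" "\<bar>v t x\<bar> \<le> M"
      using riemann_invariant_square[of L M t x] init L t by (simp_all add: riemann_def u0)
    then show ?thesis
      using eta_sublevel_bounds[OF \<gamma> u_pos L(1), of t x M] t by (simp add: \<delta>\<^sub>1_def m\<^sub>1_def)
  qed
  have main: "\<exists>K. \<forall>u\<^sub>0 v\<^sub>0 a u v. admissible A' u\<^sub>0 v\<^sub>0 a u v \<longrightarrow>
      (\<forall>t\<ge>0. ereal t < lifespan \<gamma> a u\<^sub>0 v\<^sub>0 \<longrightarrow> (u t, v t) \<in> X_space (m\<^sub>1 + M) \<delta>\<^sub>1) \<and>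
      ((\<exists>x\<^sub>0. deriv (\<lambda>x. riemann_r \<gamma> (u\<^sub>0 x) (v\<^sub>0 x)) x\<^sub>0 \<le> - K \<or>
           deriv (\<lambda>x. riemann_s \<gamma> (u\<^sub>0 x) (v\<^sub>0 x)) x\<^sub>0 \<le> - K) \<longrightarrow> lifespan \<gamma> a u\<^sub>0 v\<^sub>0 < \<infinity>)"
    if A': "0 < A'" for A'
  proof -
    obtain K where K: "\<And>d B a u v \<sigma> x\<^sub>0. damped_p_system \<gamma> 1 d B a u v \<Longrightarrow>
      (\<And>t x. t \<in> {0..1} \<Longrightarrow> \<delta>\<^sub>1 \<le> u t x \<and> u t x \<le> m\<^sub>1 \<and> \<bar>v t x\<bar> \<le> M \<and>
         a t x \<le> A \<and> \<bar>dt a t x\<bar> + \<bar>dx a t x\<bar> \<le> A') \<Longrightarrow>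
      \<bar>\<sigma>\<bar> = 1 \<Longrightarrow> damped_p_system.riemann_x \<gamma> u v \<sigma> 0 x\<^sub>0 \<le> - K \<Longrightarrow> False"
      using gradient_blowup[OF \<gamma> \<delta>\<^sub>1 less_imp_le[OF M] less_imp_le[OF A']] by metis
    show ?thesis
    proof (intro exI[of _ K] allI impI conjI)
      fix u\<^sub>0 v\<^sub>0 a u v t
      assume adm: "admissible A' u\<^sub>0 v\<^sub>0 a u v" and t: "0 \<le> t" "ereal t < lifespan \<gamma> a u\<^sub>0 v\<^sub>0"
      \<comment> \<open>A time strictly between \<open>t\<close> and the lifespan gives a regular
        solution on a half-open interval that contains \<open>t\<close>.\<close>
      obtain T where T: "t < T" "ereal T < lifespan \<gamma> a u\<^sub>0 v\<^sub>0"
        using ereal_dense2[OF t(2)] by auto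
      have reg: "regular_solution \<gamma> a u\<^sub>0 v\<^sub>0 T u v"
        using adm T t by (auto simp: admissible_def solution_on_lifespan_def)
      then have C1: "C1_on {0..<T} u" "C1_on {0..<T} v"
        by (auto simp: regular_solution_def C1_solution_def)
      obtain B where B: "\<And>x. \<bar>u t x\<bar> \<le> B \<and> \<bar>v t x\<bar> \<le> B \<and> \<bar>dx u t x\<bar> \<le> B \<and> \<bar>dx v t x\<bar> \<le> B"
        using regular_solution_bounds[OF \<gamma> reg] t T by (metis atLeastLessThan_iff)
      have C1b: "f t \<in> C1b" if f: "C1_on {0..<T} f" and B: "\<And>x. \<bar>f t x\<bar> \<le> B \<and> \<bar>dx f t x\<bar> \<le> B" for f
      proof -
        have tT: "t \<in> {0..<T}" using t T by simp
        have "continuous_on UNIV (dx f t)"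
          by (rule continuous_on_compose2[OF C1_on_continuous(2)[OF f], of UNIV "\<lambda>x. (t, x)", unfolded prod.case])
            (use tT in \<open>auto intro!: continuous_intros\<close>)
        then have "f t C1_differentiable_on UNIV"
          unfolding C1_differentiable_on_def
          using C1_on_dx[OF f tT] by (auto simp flip: has_real_derivative_iff_has_vector_derivative)
        moreover have "bounded (range (f t))" "bounded (range (deriv (f t)))"
          using B by (auto simp: bounded_iff dx_def)
        ultimately show ?thesis by (simp add: C1b_def)
      qed
      have bnd: "\<delta>\<^sub>1 \<le> u t x \<and> u t x \<le> m\<^sub>1 \<and> \<bar>v t x\<bar> \<le> M" for x
        by (rule bounds[OF adm reg t(1) T(1)])
      then have "norm (u t x) \<le> m\<^sub>1" "norm (v t x) \<le> M" for x
        using \<delta>\<^sub>1 less_le_trans[of 0 \<delta>\<^sub>1 "u t x"] by auto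
      \<comment> \<open>The norm in \<open>X_space\<close> adds the two suprema, hence the constant
        \<open>m\<^sub>1 + M\<close>.\<close>
      then have "sup_norm (u t) + sup_norm (v t) \<le> ereal m\<^sub>1 + ereal M"
        by (intro add_mono sup_norm_leI)
      then show "(u t, v t) \<in> X_space (m\<^sub>1 + M) \<delta>\<^sub>1"
        using bnd C1b[OF C1(1)] C1b[OF C1(2)] B by (auto simp: X_space_def)
    next
      fix u\<^sub>0 v\<^sub>0 a u v
      assume adm: "admissible A' u\<^sub>0 v\<^sub>0 a u v" and
        steep: "\<exists>x\<^sub>0. deriv (\<lambda>x. riemann_r \<gamma> (u\<^sub>0 x) (v\<^sub>0 x)) x\<^sub>0 \<le> - K \<or>
           deriv (\<lambda>x. riemann_s \<gamma> (u\<^sub>0 x) (v\<^sub>0 x)) x\<^sub>0 \<le> - K"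
      \<comment> \<open>The lifespan is a supremum over all regular solutions, so each of them is
        shown to end by time 1.\<close>
      have "T \<le> 1" if reg: "regular_solution \<gamma> a u\<^sub>0 v\<^sub>0 T u v" for T u v
      proof (rule ccontr)
        assume "\<not> T \<le> 1"
        then have long: "1 < T" by simp
        obtain d B where "damped_p_system \<gamma> 1 d B a u v"
          using regular_solution_damped_p_system[OF \<gamma> reg zero_le_one long] adm
          unfolding admissible_def by blast
        then interpret damped_p_system \<gamma> 1 d B a u v .
        have "u 0 = u\<^sub>0" "v 0 = v\<^sub>0"
          using reg by (auto simp: regular_solution_def C1_solution_def fun_eq_iff)
        then have "deriv (\<lambda>x. riemann_r \<gamma> (u\<^sub>0 x) (v\<^sub>0 x)) x = riemann_x (- 1) 0 x"
          "deriv (\<lambda>x. riemann_s \<gamma> (u\<^sub>0 x) (v\<^sub>0 x)) x = riemann_x 1 0 x" for x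
          using riemann_derivatives(2)[of 0 "- 1" x] riemann_derivatives(2)[of 0 1 x]
          by (auto simp: riemann_def[abs_def] riemann_r_def riemann_s_def intro!: DERIV_imp_deriv)
        then obtain \<sigma> x\<^sub>0 where "\<bar>\<sigma>\<bar> = 1" "riemann_x \<sigma> 0 x\<^sub>0 \<le> - K"
          using steep by (metis abs_1 abs_minus_cancel)
        moreover have "\<delta>\<^sub>1 \<le> u t x \<and> u t x \<le> m\<^sub>1 \<and> \<bar>v t x\<bar> \<le> M \<and>
            a t x \<le> A \<and> \<bar>dt a t x\<bar> + \<bar>dx a t x\<bar> \<le> A'" if "t \<in> {0..1}" for t x
        proof -
          have "0 \<le> t" "t < T" using that long by auto
          then show ?thesis using bounds[OF adm reg] adm by (simp add: admissible_def)
        qed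
        ultimately show False using K damped_p_system_axioms by blast
      qed
      then have "lifespan \<gamma> a u\<^sub>0 v\<^sub>0 \<le> ereal 1"
        unfolding lifespan_def by (intro Sup_least) auto
      then show "lifespan \<gamma> a u\<^sub>0 v\<^sub>0 < \<infinity>" by (rule le_less_trans) simp
    qed
  qed
  show ?thesis
  proof (rule exI[of _ "eta \<gamma> m"], rule conjI[OF eta_pos[OF \<gamma> m]],
      rule exI[of _ "m\<^sub>1 + M"], rule conjI[OF add_pos_pos[OF m\<^sub>1 M]],
      rule exI[of _ \<delta>\<^sub>1], rule conjI[OF \<delta>\<^sub>1], intro allI impI, goal_cases)
    case (1 A')
    with main obtain K where K: "\<And>u\<^sub>0 v\<^sub>0 a u v. admissible A' u\<^sub>0 v\<^sub>0 a u v \<Longrightarrow>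
      (\<forall>t\<ge>0. ereal t < lifespan \<gamma> a u\<^sub>0 v\<^sub>0 \<longrightarrow> (u t, v t) \<in> X_space (m\<^sub>1 + M) \<delta>\<^sub>1) \<and>
      ((\<exists>x\<^sub>0. deriv (\<lambda>x. riemann_r \<gamma> (u\<^sub>0 x) (v\<^sub>0 x)) x\<^sub>0 \<le> - K \<or>
           deriv (\<lambda>x. riemann_s \<gamma> (u\<^sub>0 x) (v\<^sub>0 x)) x\<^sub>0 \<le> - K) \<longrightarrow> lifespan \<gamma> a u\<^sub>0 v\<^sub>0 < \<infinity>)"
      by blast
    show ?case
    proof (rule exI[of _ K], intro allI impI, elim conjE, goal_cases)
      case (1 u\<^sub>0 v\<^sub>0 a u v u\<^sub>m v\<^sub>m)
      with D_C1[OF \<open>0 < A'\<close>] D_bounds[OF \<open>0 < A'\<close>] have "admissible A' u\<^sub>0 v\<^sub>0 a u v"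
        unfolding admissible_def by blast
      then show ?case by (rule K)
    qed
  qed
qed

section \<open>Uniform bounds from the two kinds of decay\<close>

lemma time_dampingD:
  assumes "time_damping \<mu> A A' a" "1 < \<mu>" "0 < A" "0 < A'"
  shows "C1_on {0..} a"
    and "\<forall>t\<ge>0. \<forall>x. 0 \<le> a t x \<and> a t x \<le> A \<and> \<bar>dt a t x\<bar> + \<bar>dx a t x\<bar> \<le> A'"
proof -
  show "C1_on {0..} a" using assms(1) by (simp add: time_damping_def C1b_on_def)
  have decay: "C * (1 + t) powr (- \<mu>) \<le> C" if "0 < C" "0 \<le> t" for C t
    using that assms(2) ge_one_powr_ge_zero[of "1 + t" \<mu>]
    by (simp add: powr_minus mult_le_cancel_left1 inverse_le_1_iff)
  show "\<forall>t\<ge>0. \<forall>x. 0 \<le> a t x \<and> a t x \<le> A \<and> \<bar>dt a t x\<bar> + \<bar>dx a t x\<bar> \<le> A'"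
    using assms(1) decay[OF assms(3)] decay[OF assms(4)] unfolding time_damping_def
    by (meson order_trans)
qed

lemma space_dampingD:
  assumes "space_damping \<mu> A A' a" "1 < \<mu>" "0 < A" "0 < A'"
  shows "C1_on {0..} a"
    and "\<forall>t\<ge>0. \<forall>x. 0 \<le> a t x \<and> a t x \<le> A \<and> \<bar>dt a t x\<bar> + \<bar>dx a t x\<bar> \<le> A'"
proof -
  show "C1_on {0..} a" using assms(1) by (simp add: space_damping_def C1b_on_def)
  have decay: "C * (1 + \<bar>x\<bar>) powr (- \<mu>) \<le> C" if "0 < C" for C x :: real
    using that assms(2) ge_one_powr_ge_zero[of "1 + \<bar>x\<bar>" \<mu>]
    by (simp add: powr_minus mult_le_cancel_left1 inverse_le_1_iff)
  show "\<forall>t\<ge>0. \<forall>x. 0 \<le> a t x \<and> a t x \<le> A \<and> \<bar>dt a t x\<bar> + \<bar>dx a t x\<bar> \<le> A'"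
    using assms(1) decay[OF assms(3)] decay[OF assms(4)] unfolding space_damping_def
    by (meson order_trans)
qed

text \<open>The order of the quantifiers expresses the dependence of the constants:
  \<open>\<epsilon>\<close>, \<open>m\<^sub>1\<close> and \<open>\<delta>\<^sub>1\<close> are chosen
  before \<open>A\<^sub>2\<close> or \<open>A\<^sub>4\<close>, and \<open>K\<close> after it, all of
  them before the data. The limits at minus infinity are \<open>u\<^sub>m\<close> and
  \<open>v\<^sub>m\<close>.\<close>

theorem theorem3p1:
  fixes \<gamma> \<mu> :: real
  assumes "1 < \<gamma>" and "1 < \<mu>"
  shows
    "(\<forall>m>0. \<forall>\<delta>>0. \<forall>A\<^sub>1>0. \<exists>\<epsilon>>0. \<exists>m\<^sub>1>0. \<exists>\<delta>\<^sub>1>0. \<forall>A\<^sub>2>0. \<exists>K::real.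
       \<forall>u\<^sub>0 v\<^sub>0 a u v. \<forall>u\<^sub>m>0. \<forall>v\<^sub>m.
         (u\<^sub>0, v\<^sub>0) \<in> X_space m \<delta> \<and>
         time_damping \<mu> A\<^sub>1 A\<^sub>2 a \<and>
         ((\<lambda>x. (u\<^sub>0 x, v\<^sub>0 x)) \<longlongrightarrow> (u\<^sub>m, v\<^sub>m)) at_bot \<and>
         solution_on_lifespan \<gamma> a u\<^sub>0 v\<^sub>0 u v \<and>
         sup_norm (\<lambda>(x, y). riemann_s \<gamma> (u\<^sub>0 x) (v\<^sub>0 x) + riemann_r \<gamma> (u\<^sub>0 y) (v\<^sub>0 y)) < ereal \<epsilon>
         \<longrightarrow>
         (\<forall>t\<ge>0. ereal t < lifespan \<gamma> a u\<^sub>0 v\<^sub>0 \<longrightarrow> (u t, v t) \<in> X_space m\<^sub>1 \<delta>\<^sub>1) \<and>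
         ((\<exists>x\<^sub>0. deriv (\<lambda>x. riemann_r \<gamma> (u\<^sub>0 x) (v\<^sub>0 x)) x\<^sub>0 \<le> - K \<or>
                deriv (\<lambda>x. riemann_s \<gamma> (u\<^sub>0 x) (v\<^sub>0 x)) x\<^sub>0 \<le> - K)
            \<longrightarrow> lifespan \<gamma> a u\<^sub>0 v\<^sub>0 < \<infinity>)) \<and>
     (\<forall>m>0. \<forall>\<delta>>0. \<forall>A\<^sub>3>0. \<exists>\<epsilon>>0. \<exists>m\<^sub>1>0. \<exists>\<delta>\<^sub>1>0. \<forall>A\<^sub>4>0. \<exists>K::real.
       \<forall>u\<^sub>0 v\<^sub>0 a u v. \<forall>u\<^sub>m>0. \<forall>v\<^sub>m.
         (u\<^sub>0, v\<^sub>0) \<in> X_space m \<delta> \<and>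
         space_damping \<mu> A\<^sub>3 A\<^sub>4 a \<and>
         ((\<lambda>x. (u\<^sub>0 x, v\<^sub>0 x)) \<longlongrightarrow> (u\<^sub>m, v\<^sub>m)) at_bot \<and>
         solution_on_lifespan \<gamma> a u\<^sub>0 v\<^sub>0 u v \<and>
         sup_norm (\<lambda>(x, y). riemann_s \<gamma> (u\<^sub>0 x) (v\<^sub>0 x) + riemann_r \<gamma> (u\<^sub>0 y) (v\<^sub>0 y)) < ereal \<epsilon>
         \<longrightarrow>
         (\<forall>t\<ge>0. ereal t < lifespan \<gamma> a u\<^sub>0 v\<^sub>0 \<longrightarrow> (u t, v t) \<in> X_space m\<^sub>1 \<delta>\<^sub>1) \<and>
         ((\<exists>x\<^sub>0. deriv (\<lambda>x. riemann_r \<gamma> (u\<^sub>0 x) (v\<^sub>0 x)) x\<^sub>0 \<le> - K \<or>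
                deriv (\<lambda>x. riemann_s \<gamma> (u\<^sub>0 x) (v\<^sub>0 x)) x\<^sub>0 \<le> - K)
            \<longrightarrow> lifespan \<gamma> a u\<^sub>0 v\<^sub>0 < \<infinity>))"
proof (intro conjI allI impI, goal_cases)
  case (1 m \<delta> A\<^sub>1)
  show ?case
    by (rule bounded_damping_blowup[where D = "\<lambda>A\<^sub>2. time_damping \<mu> A\<^sub>1 A\<^sub>2"])
      (use 1 assms in \<open>auto dest: time_dampingD\<close>)
next
  case (2 m \<delta> A\<^sub>3)
  show ?case
    by (rule bounded_damping_blowup[where D = "\<lambda>A\<^sub>4. space_damping \<mu> A\<^sub>3 A\<^sub>4"])
      (use 2 assms in \<open>auto dest: space_dampingD\<close>)
qed

end
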